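(* For each $X\in\mathbb{P}_m$, the map $\Phi_X:\mathbb{R}\times\mathcal{P}^1(\mathbb{P}_m)\to\mathcal{P}^1(\mathbb{P}_m)$, $\Phi_X(t,\mu)=X\#_t\mu$, is continuous (with $\mathcal{P}^1(\mathbb{P}_m)$ carrying the metric $d_1^W$) and satisfies $$\Phi_X(ts,\mu)=\Phi_X(s,\Phi_X(t,\mu)),\qquad t,s\in\mathbb{R},\ \mu\in\mathcal{P}^1(\mathbb{P}_m).$$ Moreover, for fixed $\mu\in\mathcal{P}^1(\mathbb{P}_m)$, the map $t\in\mathbb{R}\mapsto X\#_t\mu$ is locally Lipschitz with respect to $d_1^W$: for every $T>0$ there is a constant $C_T>0$ such that $d_1^W(X\#_t\mu,X\#_s\mu)\le C_T|t-s|$ for all $t,s\in[-T,T]$.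
   Context: $\mathbb{P}_m$ denotes the set of $m\times m$ complex positive definite matrices, with the Riemannian distance $d(A,B)=\|\log(A^{-1/2}BA^{-1/2})\|_2$, where $\|Z\|_2=(\mathrm{tr}\,Z^2)^{1/2}$. For $A,B\in\mathbb{P}_m$ and $t\in\mathbb{R}$, $A\#_tB:=A^{1/2}(A^{-1/2}BA^{-1/2})^tA^{1/2}$. $\mathcal{P}^1(\mathbb{P}_m)$ is the set of Borel probability measures $\mu$ on $\mathbb{P}_m$ with $\int_{\mathbb{P}_m}d(Z,W)\,d\mu(Z)<\infty$ for some (equivalently all) $W\in\mathbb{P}_m$. $X\#_t\mu$ denotes the push-forward of $\mu$ under $A\mapsto X\#_tA$. The $1$-Wasserstein distance is $d_1^W(\mu,\nu)=\inf_{\pi}\int d(A,B)\,d\pi(A,B)$, the infimum over all couplings $\pi$ of $\mu$ and $\nu$. *)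

theory Defs
  imports "HOL-Analysis.Analysis" "HOL-Probability.Probability"
begin

type_synonym 'n cmat = "complex^'n^'n"

definition adjoint_mat :: "'n::finite cmat \<Rightarrow> 'n cmat" where
  "adjoint_mat A = (\<chi> i j. cnj (A $ j $ i))"

definition unitary_mat :: "'n::finite cmat \<Rightarrow> bool" where
  "unitary_mat U \<longleftrightarrow> adjoint_mat U ** U = mat 1"

definition hermitian_mat :: "'n::finite cmat \<Rightarrow> bool" where
  "hermitian_mat A \<longleftrightarrow> adjoint_mat A = A"

definition posdef :: "'n::finite cmat \<Rightarrow> bool" where
  "posdef A \<longleftrightarrow> hermitian_mat A \<and>
     (\<forall>x::complex^'n. x \<noteq> 0 \<longrightarrow> (\<Sum>i\<in>UNIV. cnj (x $ i) * ((A *v x) $ i)) \<in> \<real> \<and>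
                         Re (\<Sum>i\<in>UNIV. cnj (x $ i) * ((A *v x) $ i)) > 0)"

definition PD :: "'n::finite cmat set" where
  "PD = {A. posdef A}"

definition diag_mat :: "('n::finite \<Rightarrow> real) \<Rightarrow> 'n cmat" where
  "diag_mat l = (\<chi> i j. if i = j then complex_of_real (l i) else 0)"

definition mat_fun :: "(real \<Rightarrow> real) \<Rightarrow> 'n::finite cmat \<Rightarrow> 'n cmat" where
  "mat_fun f A = (SOME B. \<exists>U l. unitary_mat U \<and> A = U ** diag_mat l ** adjoint_mat U \<and>
                              B = U ** diag_mat (f \<circ> l) ** adjoint_mat U)"

definition mat_pow :: "'n::finite cmat \<Rightarrow> real \<Rightarrow> 'n cmat" where
  "mat_pow A t = mat_fun (\<lambda>x. x powr t) A"

definition mat_log :: "'n::finite cmat \<Rightarrow> 'n cmat" where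
  "mat_log A = mat_fun ln A"

definition rdist :: "'n::finite cmat \<Rightarrow> 'n cmat \<Rightarrow> real" where
  "rdist A B = (let Z = mat_log (mat_pow A (-1/2) ** B ** mat_pow A (-1/2))
                in sqrt (Re (trace (Z ** Z))))"

definition geo :: "'n::finite cmat \<Rightarrow> real \<Rightarrow> 'n cmat \<Rightarrow> 'n cmat" where
  "geo A t B = mat_pow A (1/2) ** mat_pow (mat_pow A (-1/2) ** B ** mat_pow A (-1/2)) t
               ** mat_pow A (1/2)"

definition PDborel :: "'n::finite cmat measure" where
  "PDborel = restrict_space borel PD"

definition P1 :: "'n::finite cmat measure set" where
  "P1 = {\<mu>. prob_space \<mu> \<and> sets \<mu> = sets PDborel \<and>
            (\<exists>W\<in>PD. (\<integral>\<^sup>+ Z. ennreal (rdist Z W) \<partial>\<mu>) < \<infinity>)}"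

definition geo_push :: "'n::finite cmat \<Rightarrow> real \<Rightarrow> 'n cmat measure \<Rightarrow> 'n cmat measure" where
  "geo_push X t \<mu> = distr \<mu> PDborel (\<lambda>A. geo X t A)"

definition couplings :: "'n::finite cmat measure \<Rightarrow> 'n cmat measure \<Rightarrow> ('n cmat \<times> 'n cmat) measure set" where
  "couplings \<mu> \<nu> = {\<pi>. prob_space \<pi> \<and> sets \<pi> = sets (PDborel \<Otimes>\<^sub>M PDborel) \<and>
                       distr \<pi> PDborel fst = \<mu> \<and> distr \<pi> PDborel snd = \<nu>}"

definition W1 :: "'n::finite cmat measure \<Rightarrow> 'n cmat measure \<Rightarrow> real" where
  "W1 \<mu> \<nu> = enn2real (INF \<pi>\<in>couplings \<mu> \<nu>. \<integral>\<^sup>+ p. ennreal (rdist (fst p) (snd p)) \<partial>\<pi>)"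

end

theory Submission
  imports Defs
begin

text \<open>The Riemannian distance is the Euclidean norm, and the Thompson metric
  \<open>sup |log (\<langle>x, B x\<rangle> / \<langle>x, A x\<rangle>)|\<close> the maximum norm, of the logarithms of the eigenvalues of
  \<open>A\<^sup>-\<^sup>1\<^sup>/\<^sup>2 B A\<^sup>-\<^sup>1\<^sup>/\<^sup>2\<close>; they differ by a factor of at most \<open>\<surd>m\<close>. For the Thompson metric the triangle
  inequality, the invariance under congruence and the measurability are immediate, and since all the
  assertions are insensitive to constant factors, the triangle inequality for the Riemannian distance
  is never needed. The Lipschitz bound comes from \<open>d(X #\<^sub>s A, X #\<^sub>t A) \<le> \<bar>s - t\<bar> d(X, A)\<close> and the diagonal
  coupling; joint continuity from the uniform continuity of \<open>(t, A) \<mapsto> X #\<^sub>t A\<close> on balls and the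
  linear growth of \<open>d(X, X #\<^sub>t A)\<close>.\<close>

section \<open>The spectral theorem\<close>

text \<open>The joint continuity is shaped by one obstacle: uniform continuity of
  \<open>geo X t\<close> is available only on bounded sets, while a measure close to
  \<open>\<mu>\<close> in \<open>W1\<close> may still carry mass far from \<open>X\<close>. The
  remedy is asymmetric. In a coupling of \<open>\<nu>\<close> with the fixed \<open>\<mu>\<close>,
  the distance from \<open>X\<close> to the first point is at most the distance to the second point
  plus the transport distance. Hence only the tail of \<open>\<mu>\<close> enters, and every
  constant can be fixed before \<open>\<nu>\<close> is known. A congruence by
  \<open>mat_pow X (-1/2)\<close> moves \<open>X\<close> to the identity and turns
  \<open>geo X t\<close> into a plain power, which is why the estimates on powers are made around
  the identity. Their continuity is obtained in the matrix norm and carried over to the Thompson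
  metric by two comparisons that hold on balls only. \<open>mat_fun\<close> picks a diagonalisation
  by choice, so independence of that choice underlies every identity between powers.\<close>

lemma self_adjoint_eigenvector:
  fixes f :: "'a::euclidean_space \<Rightarrow> 'a"
  assumes lin: "linear f" and sym: "\<And>x y. x \<bullet> f y = f x \<bullet> y"
    and V: "subspace V" "f ` V \<subseteq> V" "\<exists>x\<in>V. x \<noteq> 0"
  shows "\<exists>x\<in>V. norm x = 1 \<and> (\<exists>l. f x = l *\<^sub>R x)"
proof -
  let ?S = "V \<inter> sphere 0 1"
  obtain v where v: "v \<in> V" "v \<noteq> 0" using V by blast
  have "compact ?S"
    using V(1) closed_subspace by (intro closed_Int_compact compact_sphere) auto
  moreover have "v /\<^sub>R norm v \<in> ?S"
    using v V(1) by (auto intro: subspace_scale)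
  moreover have "continuous_on ?S (\<lambda>x. x \<bullet> f x)"
    by (intro continuous_intros linear_continuous_on)
      (use lin in \<open>simp add: linear_conv_bounded_linear\<close>)
  ultimately obtain x where x: "x \<in> ?S" and max: "\<And>y. y \<in> ?S \<Longrightarrow> y \<bullet> f y \<le> x \<bullet> f x"
    using continuous_attains_sup[of ?S "\<lambda>x. x \<bullet> f x"] by blast
  define l where "l = x \<bullet> f x"
  have max': "z \<bullet> f z \<le> l * (z \<bullet> z)" if "z \<in> V" for z
  proof (cases "z = 0")
    case False
    then have "(z /\<^sub>R norm z) \<bullet> f (z /\<^sub>R norm z) \<le> l"
      unfolding l_def using V(1) that by (intro max) (auto intro: subspace_scale)
    then show ?thesis
      using False
      by (simp add: linear_scale[OF lin] field_simps power2_norm_eq_inner[symmetric] power2_eq_square)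
  qed (simp add: linear_0[OF lin])
  \<comment> \<open>The residual of the eigenvalue equation. Invariance of \<open>V\<close> keeps it
    in \<open>V\<close>, so maximality of \<open>x\<close> can be tested along it: a nonzero
    residual would let a small step with negative \<open>t\<close> raise the Rayleigh
    quotient.\<close>
  define y where "y = l *\<^sub>R x - f x"
  have yV: "y \<in> V"
    unfolding y_def using x V by (auto intro!: subspace_diff subspace_scale)
  have xx: "x \<bullet> x = 1" using x by (simp add: norm_eq_1)
  define b where "b = l * (y \<bullet> y) - y \<bullet> f y"
  have q: "0 \<le> 2 * t * (y \<bullet> y) + t\<^sup>2 * b" for t
  proof -
    have "(x + t *\<^sub>R y) \<bullet> f (x + t *\<^sub>R y) \<le> l * ((x + t *\<^sub>R y) \<bullet> (x + t *\<^sub>R y))"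
      using x yV V(1) by (intro max') (auto intro: subspace_add subspace_scale)
    moreover have "x \<bullet> f y = y \<bullet> f x" by (metis sym inner_commute)
    moreover have "y \<bullet> f x = l * (x \<bullet> y) - y \<bullet> y"
      using inner_diff_right[of y "l *\<^sub>R x" "f x", folded y_def] by (simp add: inner_commute)
    ultimately show ?thesis
      using xx
      by (simp add: linear_add[OF lin] linear_scale[OF lin] inner_add_left inner_add_right b_def
          l_def[symmetric] inner_commute[of y x] power2_eq_square algebra_simps)
  qed
  have "y \<bullet> y = 0"
  proof (rule ccontr)
    assume "y \<bullet> y \<noteq> 0"
    then have pos: "0 < y \<bullet> y" by simp
    \<comment> \<open>Small enough that the quadratic term costs at most half of the linear one:
      \<open>t * (\<bar>b\<bar> + 1)\<close> is exactly \<open>- (y \<bullet> y)\<close>.\<close>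
    define t where "t = - (y \<bullet> y) / (\<bar>b\<bar> + 1)"
    have "t\<^sup>2 * b \<le> t\<^sup>2 * (\<bar>b\<bar> + 1)" by (intro mult_left_mono) auto
    also have "\<dots> = t * (t * (\<bar>b\<bar> + 1))" by (simp add: power2_eq_square algebra_simps)
    also have "t * (\<bar>b\<bar> + 1) = - (y \<bullet> y)" by (simp add: t_def add_nonneg_eq_0_iff)
    finally have "0 \<le> t * (y \<bullet> y)" using q[of t] by simp
    moreover have "t < 0" using pos by (simp add: t_def field_simps)
    ultimately show False using pos by (simp add: zero_le_mult_iff)
  qed
  then have "f x = l *\<^sub>R x" by (simp add: y_def)
  then show ?thesis using x by auto
qed

lemma adjoint_mat_mult: "adjoint_mat (A ** B) = adjoint_mat B ** adjoint_mat A"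
  by (simp add: adjoint_mat_def matrix_matrix_mult_def vec_eq_iff mult.commute)

lemma adjoint_mat_adjoint_mat [simp]: "adjoint_mat (adjoint_mat A) = A"
  by (simp add: adjoint_mat_def vec_eq_iff)

lemma adjoint_diag_mat [simp]: "adjoint_mat (diag_mat l) = diag_mat l"
  by (simp add: adjoint_mat_def diag_mat_def vec_eq_iff)

text \<open>Real Euclidean geometry on complex vectors is the real part of the Hermitian product.
  This makes the real maximisation argument available for complex Hermitian matrices.\<close>

lemma inner_complex_vec: "x \<bullet> y = Re (\<Sum>i\<in>UNIV. cnj (x $ i) * y $ i)" for x y :: "complex^'n"
  by (simp add: inner_vec_def inner_complex_def)

lemma inner_adjoint_mat: "x \<bullet> (A *v y) = (adjoint_mat A *v x) \<bullet> y"
proof -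
  have "(\<Sum>i\<in>UNIV. cnj (x $ i) * (A *v y) $ i) = (\<Sum>i\<in>UNIV. \<Sum>j\<in>UNIV. cnj (x $ i) * (A $ i $ j * y $ j))"
    by (simp add: matrix_vector_mult_def sum_distrib_left)
  also have "\<dots> = (\<Sum>j\<in>UNIV. \<Sum>i\<in>UNIV. cnj (x $ i) * (A $ i $ j * y $ j))"
    by (rule sum.swap)
  also have "\<dots> = (\<Sum>j\<in>UNIV. cnj ((adjoint_mat A *v x) $ j) * y $ j)"
    by (simp add: matrix_vector_mult_def adjoint_mat_def sum_distrib_right sum_distrib_left mult_ac)
  finally show ?thesis by (simp add: inner_complex_vec)
qed

lemma unitary_matD: 
  assumes "unitary_mat U" shows "adjoint_mat U ** U = mat 1" "U ** adjoint_mat U = mat 1"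
  using assms matrix_left_right_inverse by (auto simp: unitary_mat_def)

text \<open>Stacking the conjugated vectors as rows leaves row \<open>j\<close> equal to zero, so
  the square matrix is singular and its kernel supplies the vector.\<close>

lemma unit_vector_outside:
  fixes u :: "'n \<Rightarrow> complex^'n::finite"
  assumes "j \<notin> I"
  shows "\<exists>x. x \<noteq> 0 \<and> (\<forall>i\<in>I. (\<Sum>k\<in>UNIV. cnj (u i $ k) * x $ k) = 0)"
proof -
  define M :: "complex^'n^'n" where "M = (\<chi> i k. if i \<in> I then cnj (u i $ k) else 0)"
  have "det M = 0" by (rule det_zero_row(1)[of j]) (use assms in \<open>simp add: M_def row_def vec_eq_iff\<close>)
  then have "\<not> (\<exists>B. B ** M = mat 1)"
    by (simp add: invertible_left_inverse[symmetric] invertible_det_nz)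
  then obtain x where x: "M *v x = 0" "x \<noteq> 0"
    by (auto simp: matrix_left_invertible_ker)
  have "(\<Sum>k\<in>UNIV. cnj (u i $ k) * x $ k) = (M *v x) $ i" if "i \<in> I" for i
    using that by (simp add: M_def matrix_vector_mult_def)
  then show ?thesis using x by (intro exI[of _ x]) auto
qed

lemma hermitian_mat_sesquilinear:
  assumes "hermitian_mat A"
  shows "(\<Sum>k\<in>UNIV. cnj (x $ k) * (A *v y) $ k) = (\<Sum>k\<in>UNIV. cnj ((A *v x) $ k) * y $ k)"
proof -
  have A: "cnj (A $ i $ j) = A $ j $ i" for i j
    using assms unfolding hermitian_mat_def adjoint_mat_def by (metis vec_lambda_beta)
  have "(\<Sum>i\<in>UNIV. cnj (x $ i) * (A *v y) $ i) = (\<Sum>i\<in>UNIV. \<Sum>j\<in>UNIV. cnj (x $ i) * (A $ i $ j * y $ j))"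
    by (simp add: matrix_vector_mult_def sum_distrib_left)
  also have "\<dots> = (\<Sum>j\<in>UNIV. \<Sum>i\<in>UNIV. cnj (x $ i) * (A $ i $ j * y $ j))"
    by (rule sum.swap)
  also have "\<dots> = (\<Sum>j\<in>UNIV. cnj ((A *v x) $ j) * y $ j)"
    by (simp add: matrix_vector_mult_def A sum_distrib_left sum_distrib_right mult_ac)
  finally show ?thesis .
qed

text \<open>The induction runs over the indices already served, not over the dimension: an index
  outside \<open>I\<close> guarantees room for one more eigenvector, and \<open>I = UNIV\<close>
  yields a basis indexed like the matrix.\<close>

lemma hermitian_eigenbasis:
  fixes A :: "'n::finite cmat"
  assumes A: "hermitian_mat A" and "finite I"
  shows "\<exists>(u :: 'n \<Rightarrow> complex^'n) l. (\<forall>i\<in>I. A *v u i = (l i :: real) *\<^sub>R u i) \<and>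
    (\<forall>i\<in>I. \<forall>j\<in>I. (\<Sum>k\<in>UNIV. cnj (u i $ k) * u j $ k) = (if i = j then 1 else 0))"
  using \<open>finite I\<close>
proof (induction I rule: finite_induct)
  case (insert m I)
  then obtain u :: "'n \<Rightarrow> complex^'n" and l where
    eig: "\<And>i. i \<in> I \<Longrightarrow> A *v u i = l i *\<^sub>R u i" and
    orth: "\<And>i j. i \<in> I \<Longrightarrow> j \<in> I \<Longrightarrow> (\<Sum>k\<in>UNIV. cnj (u i $ k) * u j $ k) = (if i = j then 1 else 0)"
    by blast
  \<comment> \<open>The complement is taken for the full Hermitian product. Orthogonality for the
    real inner product would control only the real part and would not make the eigenvectors the
    columns of a unitary matrix.\<close>
  define V where "V = {x. \<forall>i\<in>I. (\<Sum>k\<in>UNIV. cnj (u i $ k) * x $ k) = 0}"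
  have "subspace V"
    by (auto simp: subspace_def V_def distrib_left sum.distrib scaleR_sum_right[symmetric])
  moreover have "(*v) A ` V \<subseteq> V"
    by (auto simp: V_def hermitian_mat_sesquilinear[OF A] eig scaleR_sum_right[symmetric])
  moreover have "\<exists>x\<in>V. x \<noteq> 0"
    using unit_vector_outside[OF insert.hyps(2), of u] by (auto simp: V_def)
  moreover have "x \<bullet> (A *v y) = (A *v x) \<bullet> y" for x y
    using A by (simp add: inner_adjoint_mat hermitian_mat_def)
  ultimately obtain x c where x: "x \<in> V" "norm x = 1" "A *v x = c *\<^sub>R x"
    using self_adjoint_eigenvector[OF matrix_vector_mul_linear[of A], of V] by blast
  have "(\<Sum>k\<in>UNIV. cnj (x $ k) * x $ k) = (\<Sum>k\<in>UNIV. of_real ((norm (x $ k))\<^sup>2))"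
    by (intro sum.cong refl) (metis complex_norm_square mult.commute)
  also have "\<dots> = of_real ((norm x)\<^sup>2)"
    by (simp add: norm_vec_def L2_set_def sum_nonneg)
  finally have xx: "(\<Sum>k\<in>UNIV. cnj (x $ k) * x $ k) = 1" using x by simp
  have ux: "(\<Sum>k\<in>UNIV. cnj (u i $ k) * x $ k) = 0" if "i \<in> I" for i
    using x that by (simp add: V_def)
  have xu: "(\<Sum>k\<in>UNIV. cnj (x $ k) * u i $ k) = 0" if "i \<in> I" for i
  proof -
    have "(\<Sum>k\<in>UNIV. cnj (x $ k) * u i $ k) = cnj (\<Sum>k\<in>UNIV. cnj (u i $ k) * x $ k)"
      by (simp add: mult.commute)
    then show ?thesis using ux[OF that] by simp
  qed
  show ?case
    by (rule exI[of _ "u(m := x)"], rule exI[of _ "l(m := c)"])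
      (use insert.hyps(2) eig orth x xx ux xu in auto)
qed auto

theorem hermitian_spectral:
  assumes "hermitian_mat A"
  obtains U l where "unitary_mat U" "A = U ** diag_mat l ** adjoint_mat U"
proof -
  obtain u :: "'a \<Rightarrow> complex^'a" and l where
    eig: "\<And>i. A *v u i = l i *\<^sub>R u i" and
    orth: "\<And>i j. (\<Sum>k\<in>UNIV. cnj (u i $ k) * u j $ k) = (if i = j then 1 else 0)"
    using hermitian_eigenbasis[OF assms, of UNIV] by auto
  define U where "U = (\<chi> k i. u i $ k)"
  have U: "unitary_mat U"
    by (simp add: unitary_mat_def adjoint_mat_def matrix_matrix_mult_def U_def mat_def orth vec_eq_iff)
  have "(A ** U) $ k $ i = (U ** diag_mat l) $ k $ i" for k i
  proof -
    have "(A ** U) $ k $ i = (A *v u i) $ k"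
      by (simp add: matrix_matrix_mult_def matrix_vector_mult_def U_def)
    also have "\<dots> = of_real (l i) * u i $ k"
      by (simp add: eig scaleR_conv_of_real[where 'a = complex])
    also have "\<dots> = (U ** diag_mat l) $ k $ i"
      by (simp add: matrix_matrix_mult_def diag_mat_def U_def if_distrib[of "(*) _"] sum.delta'
          mult.commute cong: if_cong)
    finally show ?thesis .
  qed
  then have "A ** U = U ** diag_mat l" by (simp add: vec_eq_iff)
  then have "A = U ** diag_mat l ** adjoint_mat U"
    by (metis U unitary_matD(2) matrix_mul_assoc matrix_mul_rid)
  with U show thesis by (rule that)
qed

section \<open>Functional calculus\<close>

lemma diag_mat_mult: "diag_mat l ** diag_mat m = diag_mat (\<lambda>i. l i * m i)"
proof -
  have "(diag_mat l ** diag_mat m) $ i $ j = (\<Sum>k\<in>UNIV. if i = k then diag_mat l $ i $ i * diag_mat m $ i $ j else 0)" for i j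
    unfolding matrix_matrix_mult_def by (simp only: vec_lambda_beta, rule sum.cong) (auto simp: diag_mat_def)
  then show ?thesis by (simp add: vec_eq_iff) (simp add: diag_mat_def)
qed

lemma diag_mat_one: "diag_mat (\<lambda>i. 1) = mat 1"
  by (simp add: diag_mat_def mat_def vec_eq_iff)

lemma diag_mat_mult_left_nth: "(diag_mat l ** W) $ i $ j = of_real (l i) * W $ i $ j"
proof -
  have "(diag_mat l ** W) $ i $ j = (\<Sum>k\<in>UNIV. if i = k then of_real (l i) * W $ i $ j else 0)"
    unfolding matrix_matrix_mult_def by (simp only: vec_lambda_beta, rule sum.cong) (auto simp: diag_mat_def)
  then show ?thesis by simp
qed

lemma diag_mat_mult_right_nth: "(W ** diag_mat l) $ i $ j = W $ i $ j * of_real (l j)"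
proof -
  have "(W ** diag_mat l) $ i $ j = (\<Sum>k\<in>UNIV. if k = j then W $ i $ j * of_real (l j) else 0)"
    unfolding matrix_matrix_mult_def by (simp only: vec_lambda_beta, rule sum.cong) (auto simp: diag_mat_def)
  then show ?thesis by simp
qed

text \<open>The intertwiner \<open>W\<close> of the two diagonalisations satisfies \<open>W $ i $ j = 0\<close> unless the
  eigenvalues \<open>m i\<close> and \<open>l j\<close> agree, so it also intertwines every function of them.\<close>

lemma mat_fun_unitary_diag:
  assumes U: "unitary_mat U"
  shows "mat_fun f (U ** diag_mat l ** adjoint_mat U) = U ** diag_mat (f \<circ> l) ** adjoint_mat U"
proof -
  have eq: "V ** diag_mat (f \<circ> m) ** adjoint_mat V = U ** diag_mat (f \<circ> l) ** adjoint_mat U"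
    if V: "unitary_mat V" and VU: "U ** diag_mat l ** adjoint_mat U = V ** diag_mat m ** adjoint_mat V" for V m
  proof -
    define W where "W = adjoint_mat V ** U"
    have "W ** diag_mat l = adjoint_mat V ** (U ** diag_mat l ** adjoint_mat U) ** U"
      by (metis W_def U unitary_matD(1) matrix_mul_assoc matrix_mul_rid)
    also have "\<dots> = diag_mat m ** W"
      unfolding VU W_def by (metis V unitary_matD(1) matrix_mul_assoc matrix_mul_lid)
    finally have *: "W $ i $ j * of_real (l j) = of_real (m i) * W $ i $ j" for i j
      by (metis diag_mat_mult_left_nth diag_mat_mult_right_nth)
    have "W $ i $ j = 0 \<or> l j = m i" for i j
      using *[of i j] by (auto simp: mult.commute)
    then have "W ** diag_mat (f \<circ> l) = diag_mat (f \<circ> m) ** W"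
      unfolding vec_eq_iff diag_mat_mult_left_nth diag_mat_mult_right_nth o_def
      by (metis mult.commute mult_zero_left)
    then have "V ** (W ** diag_mat (f \<circ> l)) ** adjoint_mat U = V ** (diag_mat (f \<circ> m) ** W) ** adjoint_mat U"
      by simp
    moreover have "V ** W = U"
      unfolding W_def by (metis V unitary_matD(2) matrix_mul_assoc matrix_mul_lid)
    moreover have "W ** adjoint_mat U = adjoint_mat V"
      unfolding W_def by (metis U unitary_matD(2) matrix_mul_assoc matrix_mul_rid)
    ultimately show ?thesis by (metis matrix_mul_assoc)
  qed
  show ?thesis
    unfolding mat_fun_def
  proof (rule someI2)
    show "\<exists>V m. unitary_mat V \<and> U ** diag_mat l ** adjoint_mat U = V ** diag_mat m ** adjoint_mat V \<and>
        U ** diag_mat (f \<circ> l) ** adjoint_mat U = V ** diag_mat (f \<circ> m) ** adjoint_mat V"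
      using U by blast
  qed (use eq in blast)
qed

text \<open>A Hermitian form equals its own conjugate, hence is real. Positive definiteness becomes
  positivity of the real quadratic form, the shape in which \<open>log_ratio\<close> uses
  it.\<close>

lemma PD_iff: "A \<in> PD \<longleftrightarrow> hermitian_mat A \<and> (\<forall>x. x \<noteq> 0 \<longrightarrow> 0 < x \<bullet> (A *v x))"
proof -
  have "(\<Sum>i\<in>UNIV. cnj (x $ i) * (A *v x) $ i) \<in> \<real>" if "hermitian_mat A" for x
  proof -
    have "cnj (\<Sum>i\<in>UNIV. cnj (x $ i) * (A *v x) $ i) = (\<Sum>i\<in>UNIV. cnj ((A *v x) $ i) * x $ i)"
      by (simp add: mult.commute)
    then show ?thesis
      using hermitian_mat_sesquilinear[OF that, of x x] by (simp add: Reals_cnj_iff)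
  qed
  then show ?thesis
    unfolding PD_def posdef_def inner_complex_vec by auto
qed

lemma quad_conj: "x \<bullet> ((M ** A ** adjoint_mat M) *v x) = (adjoint_mat M *v x) \<bullet> (A *v (adjoint_mat M *v x))"
  by (simp add: matrix_vector_mul_assoc[symmetric] inner_adjoint_mat)

lemma hermitian_conj: "hermitian_mat A \<Longrightarrow> hermitian_mat (M ** A ** adjoint_mat M)"
  by (simp add: hermitian_mat_def adjoint_mat_mult matrix_mul_assoc)

lemma inner_diag_mat: "x \<bullet> (diag_mat l *v x) = (\<Sum>i\<in>UNIV. l i * (norm (x $ i))\<^sup>2)"
proof -
  have "(diag_mat l *v x) $ i = l i *\<^sub>R x $ i" for i
  proof -
    have "(diag_mat l *v x) $ i = (\<Sum>k\<in>UNIV. if i = k then of_real (l i) * x $ i else 0)"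
      unfolding matrix_vector_mult_def by (simp only: vec_lambda_beta, rule sum.cong) (auto simp: diag_mat_def)
    then show ?thesis by (simp add: scaleR_conv_of_real)
  qed
  then show ?thesis by (simp add: inner_vec_def power2_norm_eq_inner)
qed

lemma quad_unitary_diag:
  "x \<bullet> ((U ** diag_mat l ** adjoint_mat U) *v x) = (\<Sum>i\<in>UNIV. l i * (norm ((adjoint_mat U *v x) $ i))\<^sup>2)"
  by (simp add: quad_conj inner_diag_mat)

lemma invertible_adjoint_mat: "invertible M \<Longrightarrow> invertible (adjoint_mat M)"
proof -
  have "adjoint_mat (mat 1) = (mat 1 :: 'n::finite cmat)"
    by (simp add: adjoint_mat_def mat_def vec_eq_iff)
  then show "invertible M \<Longrightarrow> invertible (adjoint_mat M)"
    unfolding invertible_def by (metis adjoint_mat_mult)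
qed

lemma invertible_mult_eq_0: "invertible M \<Longrightarrow> M *v x = 0 \<longleftrightarrow> x = 0" for M :: "'a::field^'n^'n"
  by (metis invertible_left_inverse matrix_left_invertible_ker matrix_vector_mult_0_right)

lemma PD_conj: 
  assumes "A \<in> PD" "invertible M" shows "M ** A ** adjoint_mat M \<in> PD"
  using assms invertible_mult_eq_0[OF invertible_adjoint_mat[OF assms(2)]]
  by (auto simp: PD_iff quad_conj hermitian_conj)

lemma unitary_diag_PD:
  assumes "unitary_mat U" "\<And>i. 0 < l i" shows "U ** diag_mat l ** adjoint_mat U \<in> PD"
proof (intro PD_conj)
  show "invertible U" using unitary_matD[OF assms(1)] by (auto simp: invertible_def)
  have "0 < (\<Sum>i\<in>UNIV. l i * (norm (x $ i))\<^sup>2)" if x: "x \<noteq> 0" for x :: "complex^'a"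
  proof -
    obtain i where "x $ i \<noteq> 0" using x by (metis vec_eq_iff zero_index)
    then show ?thesis
      by (intro sum_pos2[of _ i]) (auto simp: assms(2) less_imp_le)
  qed
  then show "diag_mat l \<in> PD"
    by (simp add: PD_iff inner_diag_mat hermitian_mat_def)
qed

text \<open>The vector is column \<open>i\<close> of \<open>U\<close>. It is the same for every
  \<open>l\<close>, so constant \<open>l\<close> yields its normalisation and any other
  \<open>l\<close> exhibits the eigenvalue as a value of the quadratic form. Bounds on forms thereby
  become bounds on eigenvalues.\<close>

lemma unitary_eigenvector:
  assumes U: "unitary_mat U"
  obtains x where "x \<bullet> x = 1" "\<And>l. x \<bullet> ((U ** diag_mat l ** adjoint_mat U) *v x) = l i"
proof
  define x where "x = U *v axis i 1"
  have Ux: "adjoint_mat U *v x = axis i 1"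
    unfolding x_def by (simp add: matrix_vector_mul_assoc unitary_matD[OF U])
  show "x \<bullet> ((U ** diag_mat l ** adjoint_mat U) *v x) = l i" for l
    by (simp add: quad_unitary_diag Ux axis_def if_distrib[of "\<lambda>x. _ * x"] if_distrib[of norm]
          if_distrib[of "\<lambda>x. x\<^sup>2"] cong: if_cong)
  from this[of "\<lambda>_. 1"] show "x \<bullet> x = 1"
    by (simp add: diag_mat_one unitary_matD[OF U])
qed

lemma PD_spectral:
  assumes "A \<in> PD"
  obtains U l where "unitary_mat U" "\<And>i. 0 < l i" "A = U ** diag_mat l ** adjoint_mat U"
proof -
  obtain U l where U: "unitary_mat U" and A: "A = U ** diag_mat l ** adjoint_mat U"
    using assms hermitian_spectral by (auto simp: PD_iff)
  have "0 < l i" for i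
  proof -
    obtain x where "x \<bullet> x = 1" "x \<bullet> (A *v x) = l i"
      unfolding A using unitary_eigenvector[OF U] by metis
    moreover from this(1) have "x \<noteq> 0" by auto
    ultimately show ?thesis using assms by (auto simp: PD_iff)
  qed
  then show thesis using U A that by blast
qed

section \<open>Real powers of positive definite matrices\<close>

lemma mat_pow_unitary_diag:
  "unitary_mat U \<Longrightarrow> mat_pow (U ** diag_mat l ** adjoint_mat U) t = U ** diag_mat (\<lambda>i. l i powr t) ** adjoint_mat U"
  by (simp add: mat_pow_def mat_fun_unitary_diag o_def)

lemma mat_pow_PD:
  assumes "A \<in> PD" shows "mat_pow A t \<in> PD"
proof -
  obtain U l where U: "unitary_mat U" and l: "\<And>i. 0 < l i" and A: "A = U ** diag_mat l ** adjoint_mat U"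
    using PD_spectral[OF assms] by metis
  have "0 < l i powr t" for i using l[of i] by simp
  then show ?thesis by (simp add: A mat_pow_unitary_diag U unitary_diag_PD)
qed

lemma mat_pow_add:
  assumes "A \<in> PD" shows "mat_pow A s ** mat_pow A t = mat_pow A (s + t)"
proof -
  obtain U l where U: "unitary_mat U" and A: "A = U ** diag_mat l ** adjoint_mat U"
    using PD_spectral[OF assms] by metis
  have "mat_pow A s ** mat_pow A t =
      U ** diag_mat (\<lambda>i. l i powr s) ** (adjoint_mat U ** U) ** diag_mat (\<lambda>i. l i powr t) ** adjoint_mat U"
    by (simp add: A U mat_pow_unitary_diag matrix_mul_assoc)
  also have "\<dots> = U ** (diag_mat (\<lambda>i. l i powr s) ** diag_mat (\<lambda>i. l i powr t)) ** adjoint_mat U"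
    by (simp add: unitary_matD[OF U] matrix_mul_assoc)
  also have "\<dots> = mat_pow A (s + t)"
    by (simp add: A U mat_pow_unitary_diag diag_mat_mult powr_add)
  finally show ?thesis .
qed

lemma mat_pow_0:
  assumes "A \<in> PD" shows "mat_pow A 0 = mat 1"
proof -
  obtain U l where U: "unitary_mat U" and l: "\<And>i. 0 < l i" and A: "A = U ** diag_mat l ** adjoint_mat U"
    using PD_spectral[OF assms] by metis
  have "l i \<noteq> 0" for i using l[of i] by simp
  then show ?thesis by (simp add: A mat_pow_unitary_diag U diag_mat_one unitary_matD)
qed

lemma mat_pow_1: "A \<in> PD \<Longrightarrow> mat_pow A 1 = A"
  by (elim PD_spectral) (simp add: mat_pow_unitary_diag less_imp_le)

lemma mat_pow_mat_pow: "A \<in> PD \<Longrightarrow> mat_pow (mat_pow A t) s = mat_pow A (t * s)"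
  by (elim PD_spectral) (simp add: mat_pow_unitary_diag powr_powr)

lemma mat_pow_minus:
  assumes "A \<in> PD"
  shows "mat_pow A t ** mat_pow A (- t) = mat 1" "mat_pow A (- t) ** mat_pow A t = mat 1"
  using assms by (simp_all add: mat_pow_add mat_pow_0)

lemma adjoint_mat_pow: "A \<in> PD \<Longrightarrow> adjoint_mat (mat_pow A t) = mat_pow A t"
  using mat_pow_PD[of A t] by (simp add: PD_iff hermitian_mat_def)

lemma invertible_mat_pow: "A \<in> PD \<Longrightarrow> invertible (mat_pow A t)"
  unfolding invertible_def using mat_pow_minus by blast

section \<open>The Thompson metric\<close>

lemma whitening:
  assumes "A \<in> PD"
  shows "mat_pow A (-1/2) ** A ** mat_pow A (-1/2) = mat 1"
proof -
  have "mat_pow A (-1/2) ** mat_pow A 1 ** mat_pow A (-1/2) = mat_pow A (-1/2 + 1 + -1/2)"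
    by (simp only: mat_pow_add[OF assms])
  then show ?thesis using assms by (simp add: mat_pow_0 mat_pow_1)
qed

lemma mat_pow_conj_PD:
  assumes "A \<in> PD" "B \<in> PD"
  shows "mat_pow A t ** B ** mat_pow A t \<in> PD"
  using PD_conj[OF assms(2) invertible_mat_pow[OF assms(1)], of t] adjoint_mat_pow[OF assms(1), of t] by simp

lemma one_PD: "mat 1 \<in> PD"
proof -
  have "hermitian_mat (mat 1)"
    by (simp add: hermitian_mat_def adjoint_mat_def mat_def vec_eq_iff)
  then show ?thesis by (simp add: PD_iff)
qed

text \<open>The unitary factors cancel inside the square and, by cyclicity of the trace, around it.
  This is the only place where \<open>rdist\<close> is unfolded.\<close>

lemma rdist_spectral:
  assumes "mat_pow A (-1/2) ** B ** mat_pow A (-1/2) = U ** diag_mat l ** adjoint_mat U" "unitary_mat U"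
  shows "rdist A B = sqrt (\<Sum>i\<in>UNIV. (ln (l i))\<^sup>2)"
proof -
  let ?D = "diag_mat (ln \<circ> l)"
  have "(U ** ?D ** adjoint_mat U) ** (U ** ?D ** adjoint_mat U)
      = U ** (?D ** (adjoint_mat U ** U) ** ?D) ** adjoint_mat U"
    by (simp only: matrix_mul_assoc)
  also have "\<dots> = U ** (diag_mat (\<lambda>i. (ln (l i))\<^sup>2)) ** adjoint_mat U"
    by (simp add: unitary_matD[OF assms(2)] diag_mat_mult power2_eq_square)
  also have "trace \<dots> = trace (adjoint_mat U ** (U ** diag_mat (\<lambda>i. (ln (l i))\<^sup>2)))"
    by (rule trace_mul_sym)
  also have "\<dots> = (\<Sum>i\<in>UNIV. (ln (l i))\<^sup>2)"
    by (simp add: matrix_mul_assoc unitary_matD[OF assms(2)] trace_def diag_mat_def)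
  finally show ?thesis
    using assms by (simp add: rdist_def Let_def mat_log_def mat_fun_unitary_diag)
qed

text \<open>The difference of logarithms is unchanged under scaling of \<open>x\<close>, a
  congruence acts on it by substitution, and the triangle inequality holds vector by vector.\<close>

definition log_ratio :: "'n::finite cmat \<Rightarrow> 'n cmat \<Rightarrow> complex^'n \<Rightarrow> real" where
  "log_ratio A B x = \<bar>ln (x \<bullet> (B *v x)) - ln (x \<bullet> (A *v x))\<bar>"

text \<open>These are the Loewner inequalities between each matrix and \<open>exp c\<close> times
  the other, tested at \<open>x\<close>. Free of logarithms and linear in the matrices, they can be
  summed over eigenvectors, pass to limits and compare with norms.\<close>

lemma log_ratio_le_iff:
  assumes "A \<in> PD" "B \<in> PD" "x \<noteq> 0"
  shows "log_ratio A B x \<le> c \<longleftrightarrow>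
    x \<bullet> (B *v x) \<le> exp c * (x \<bullet> (A *v x)) \<and> x \<bullet> (A *v x) \<le> exp c * (x \<bullet> (B *v x))"
proof -
  have pos: "0 < x \<bullet> (A *v x)" "0 < x \<bullet> (B *v x)" using assms by (auto simp: PD_iff)
  have *: "b \<le> exp c * a \<longleftrightarrow> ln b \<le> c + ln a" if "0 < a" "0 < b" for a b :: real
  proof -
    have "b \<le> exp c * a \<longleftrightarrow> ln b \<le> ln (exp c * a)"
      using that by (subst ln_le_cancel_iff) auto
    then show ?thesis using that by (simp add: ln_mult)
  qed
  show ?thesis
    unfolding log_ratio_def using pos by (simp add: *) linarith
qed

lemma log_ratio_conj:
  "log_ratio (M ** A ** adjoint_mat M) (M ** B ** adjoint_mat M) x = log_ratio A B (adjoint_mat M *v x)"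
  by (simp add: log_ratio_def quad_conj)

text \<open>In a common eigenbasis both forms are sums of the same squares with weights
  \<open>l i\<close> and \<open>m i\<close>, so inequalities between the weights carry over term by
  term.\<close>

lemma log_ratio_unitary_diag_le:
  assumes U: "unitary_mat U" and l: "\<And>i. 0 < l i" and m: "\<And>i. 0 < m i" and "x \<noteq> 0"
    and c: "\<And>i. \<bar>ln (m i) - ln (l i)\<bar> \<le> c"
  shows "log_ratio (U ** diag_mat l ** adjoint_mat U) (U ** diag_mat m ** adjoint_mat U) x \<le> c"
proof -
  have *: "b \<le> exp c * a" if "0 < a" "0 < b" "\<bar>ln b - ln a\<bar> \<le> c" for a b :: real
  proof -
    have "ln b \<le> ln (exp c * a)" using that by (simp add: ln_mult)
    then show ?thesis using that by (subst (asm) ln_le_cancel_iff) auto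
  qed
  have "m i \<le> exp c * l i" "l i \<le> exp c * m i" for i
    using *[of "l i" "m i"] *[of "m i" "l i"] l m c[of i] by (auto simp: abs_minus_commute)
  then have "m i * a\<^sup>2 \<le> exp c * (l i * a\<^sup>2)" "l i * a\<^sup>2 \<le> exp c * (m i * a\<^sup>2)" for i a
    by (metis mult.assoc mult_right_mono zero_le_power2)+
  then show ?thesis
    using assms by (simp add: log_ratio_le_iff unitary_diag_PD quad_unitary_diag sum_distrib_left sum_mono)
qed

lemma ln_eigenvalue_le:
  assumes U: "unitary_mat U" and "\<And>x. x \<noteq> 0 \<Longrightarrow> log_ratio (mat 1) (U ** diag_mat l ** adjoint_mat U) x \<le> c"
  shows "\<bar>ln (l i)\<bar> \<le> c"
proof -
  obtain x where x: "x \<bullet> x = 1" "x \<bullet> ((U ** diag_mat l ** adjoint_mat U) *v x) = l i"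
    using unitary_eigenvector[OF U] by metis
  then have "x \<noteq> 0" by auto
  from assms(2)[OF this] show ?thesis using x by (simp add: log_ratio_def)
qed

lemma log_ratio_whiten:
  assumes "A \<in> PD"
  shows "log_ratio A B x =
    log_ratio (mat 1) (mat_pow A (-1/2) ** B ** mat_pow A (-1/2)) (mat_pow A (1/2) *v x)"
proof -
  have "mat_pow A (-1/2) *v (mat_pow A (1/2) *v x) = x"
    using mat_pow_minus(2)[OF assms, of "1/2"] by (simp add: matrix_vector_mul_assoc)
  then show ?thesis
    using log_ratio_conj[of "mat_pow A (-1/2)" A B] whitening[OF assms] adjoint_mat_pow[OF assms, of "-1/2"] by simp
qed

lemma log_ratio_le_rdist:
  assumes "A \<in> PD" "B \<in> PD" "x \<noteq> 0"
  shows "log_ratio A B x \<le> rdist A B"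
proof -
  obtain U l where U: "unitary_mat U" and l: "\<And>i. 0 < l i"
    and C: "mat_pow A (-1/2) ** B ** mat_pow A (-1/2) = U ** diag_mat l ** adjoint_mat U"
    using PD_spectral[OF mat_pow_conj_PD[OF assms(1,2)]] by metis
  have "\<bar>ln (l i)\<bar> \<le> rdist A B" for i
  proof -
    have "(ln (l i))\<^sup>2 \<le> (\<Sum>i\<in>UNIV. (ln (l i))\<^sup>2)"
      by (rule member_le_sum) auto
    then show ?thesis
      unfolding rdist_spectral[OF C U] by (metis real_sqrt_abs real_sqrt_le_mono)
  qed
  moreover have "mat_pow A (1/2) *v x \<noteq> 0"
    using assms invertible_mult_eq_0[OF invertible_mat_pow[OF assms(1), of "1/2"]] by simp
  ultimately show ?thesis
    using log_ratio_unitary_diag_le[OF U, of "\<lambda>_. 1" l] l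
    unfolding log_ratio_whiten[OF assms(1)] C by (simp add: diag_mat_one unitary_matD[OF U])
qed

lemma rdist_le:
  fixes A :: "'n::finite cmat"
  assumes "A \<in> PD" "B \<in> PD" and c: "\<And>x. x \<noteq> 0 \<Longrightarrow> log_ratio A B x \<le> c"
  shows "rdist A B \<le> sqrt (real CARD('n)) * c"
proof -
  obtain U l where U: "unitary_mat U" and l: "\<And>i. 0 < l i"
    and C: "mat_pow A (-1/2) ** B ** mat_pow A (-1/2) = U ** diag_mat l ** adjoint_mat U"
    using PD_spectral[OF mat_pow_conj_PD[OF assms(1,2)]] by metis
  have *: "\<bar>ln (l i)\<bar> \<le> c" for i
  proof (rule ln_eigenvalue_le[OF U])
    fix y :: "complex^'n" assume "y \<noteq> 0"
    have y: "mat_pow A (1/2) *v (mat_pow A (-1/2) *v y) = y"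
      using mat_pow_minus(1)[OF assms(1), of "1/2"] by (simp add: matrix_vector_mul_assoc)
    with \<open>y \<noteq> 0\<close> have "mat_pow A (-1/2) *v y \<noteq> 0" by auto
    from c[OF this] show "log_ratio (mat 1) (U ** diag_mat l ** adjoint_mat U) y \<le> c"
      unfolding log_ratio_whiten[OF assms(1)] y C .
  qed
  then have "0 \<le> c" by (meson abs_ge_zero order_trans)
  have "(\<Sum>i\<in>UNIV. (ln (l i))\<^sup>2) \<le> (\<Sum>i\<in>(UNIV::'n set). c\<^sup>2)"
    using * by (intro sum_mono) (metis abs_ge_zero power2_abs power_mono)
  then have "rdist A B \<le> sqrt (real CARD('n) * c\<^sup>2)"
    unfolding rdist_spectral[OF C U] by (intro real_sqrt_le_mono) simp
  then show ?thesis using \<open>0 \<le> c\<close> by (simp add: real_sqrt_mult)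
qed

definition thompson :: "'n::finite cmat \<Rightarrow> 'n cmat \<Rightarrow> real" where
  "thompson A B = (SUP x\<in>-{0}. log_ratio A B x)"

text \<open>A supremum of reals is meaningful only for a nonempty set that is bounded above. A unit
  vector gives the former, and \<open>rdist\<close> is the upper bound.\<close>

lemma thompson_le_iff:
  fixes A :: "'n::finite cmat"
  assumes "A \<in> PD" "B \<in> PD"
  shows "thompson A B \<le> c \<longleftrightarrow> (\<forall>x. x \<noteq> 0 \<longrightarrow> log_ratio A B x \<le> c)"
proof -
  have "(axis undefined 1 :: complex^'n) \<in> -{0}" by (simp add: axis_eq_0_iff)
  moreover have "bdd_above (log_ratio A B ` (-{0}))"
    using log_ratio_le_rdist[OF assms] by (intro bdd_aboveI2[of _ _ "rdist A B"]) auto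
  ultimately show ?thesis unfolding thompson_def by (subst cSUP_le_iff) auto
qed

lemma log_ratio_le_thompson:
  "A \<in> PD \<Longrightarrow> B \<in> PD \<Longrightarrow> x \<noteq> 0 \<Longrightarrow> log_ratio A B x \<le> thompson A B"
  using thompson_le_iff by blast

lemma thompson_nonneg:
  fixes A :: "'n::finite cmat"
  assumes "A \<in> PD" "B \<in> PD"
  shows "0 \<le> thompson A B"
proof -
  have "(axis undefined 1 :: complex^'n) \<noteq> 0" by (simp add: axis_eq_0_iff)
  from log_ratio_le_thompson[OF assms this] show ?thesis by (simp add: log_ratio_def)
qed

lemma thompson_commute: "thompson A B = thompson B A"
  by (simp add: thompson_def log_ratio_def abs_minus_commute)

lemma thompson_triangle:
  assumes "A \<in> PD" "B \<in> PD" "C \<in> PD"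
  shows "thompson A C \<le> thompson A B + thompson B C"
  unfolding thompson_le_iff[OF assms(1,3)]
proof safe
  fix x :: "complex^'a" assume "x \<noteq> 0"
  then have "log_ratio A B x \<le> thompson A B" "log_ratio B C x \<le> thompson B C"
    using assms by (auto intro: log_ratio_le_thompson)
  then show "log_ratio A C x \<le> thompson A B + thompson B C"
    unfolding log_ratio_def by linarith
qed

lemma thompson_le_rdist: "A \<in> PD \<Longrightarrow> B \<in> PD \<Longrightarrow> thompson A B \<le> rdist A B"
  by (simp add: thompson_le_iff log_ratio_le_rdist)

lemma rdist_le_thompson:
  "A \<in> PD \<Longrightarrow> B \<in> PD \<Longrightarrow> rdist A B \<le> sqrt (real CARD('n)) * thompson A B" for A :: "'n::finite cmat"
  by (intro rdist_le log_ratio_le_thompson)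

text \<open>Congruence replaces \<open>x\<close> by \<open>adjoint_mat M *v x\<close>, a bijection
  of the nonzero vectors, so both suprema run over the same set of values.\<close>

lemma thompson_conj:
  fixes A :: "'n::finite cmat"
  assumes "invertible M"
  shows "thompson (M ** A ** adjoint_mat M) (M ** B ** adjoint_mat M) = thompson A B"
proof -
  obtain N where N: "adjoint_mat M ** N = mat 1"
    using invertible_adjoint_mat[OF assms] by (auto simp: invertible_def)
  have inj: "adjoint_mat M *v x = 0 \<longleftrightarrow> x = 0" for x
    by (rule invertible_mult_eq_0[OF invertible_adjoint_mat[OF assms]])
  have surj: "adjoint_mat M *v (N *v y) = y" for y
    by (simp add: matrix_vector_mul_assoc N)
  have "(*v) (adjoint_mat M) ` (-{0}) = -{0 :: complex^'n}"
  proof (intro equalityI subsetI)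
    fix y :: "complex^'n" assume "y \<in> -{0}"
    then have "N *v y \<in> -{0}" using inj[of "N *v y"] by (simp add: surj)
    then show "y \<in> (*v) (adjoint_mat M) ` (-{0})"
      by (rule image_eqI[rotated]) (simp only: surj)
  next
    fix y :: "complex^'n" assume "y \<in> (*v) (adjoint_mat M) ` (-{0})"
    then show "y \<in> -{0}" by (elim imageE) (simp only: inj Compl_iff singleton_iff not_False_eq_True)
  qed
  then have "(SUP x\<in>-{0}. log_ratio A B x) = (SUP x\<in>(*v) (adjoint_mat M) ` (-{0}). log_ratio A B x)"
    by (simp only:)
  then show ?thesis
    by (simp add: thompson_def log_ratio_conj image_image)
qed

text \<open>All powers share one eigenbasis, and the logarithms of their eigenvalues are linear in
  the exponent. After whitening this becomes the Lipschitz bound along geodesics.\<close>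

lemma thompson_mat_pow:
  assumes "A \<in> PD"
  shows "thompson (mat_pow A s) (mat_pow A t) \<le> \<bar>t - s\<bar> * thompson (mat 1) A"
proof -
  obtain U l where U: "unitary_mat U" and l: "\<And>i. 0 < l i" and A: "A = U ** diag_mat l ** adjoint_mat U"
    using PD_spectral[OF assms] by metis 
  have "\<bar>ln (l i)\<bar> \<le> thompson (mat 1) A" for i
    by (rule ln_eigenvalue_le[OF U])
      (use log_ratio_le_thompson[OF one_PD assms] in \<open>simp add: A\<close>)
  then have "\<bar>ln (l i powr t) - ln (l i powr s)\<bar> \<le> \<bar>t - s\<bar> * thompson (mat 1) A" for i
    using l[of i] by (simp add: ln_powr left_diff_distrib[symmetric] abs_mult mult_left_mono)
  moreover have "mat_pow A s = U ** diag_mat (\<lambda>i. l i powr s) ** adjoint_mat U" for s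
    by (simp add: A U mat_pow_unitary_diag)
  ultimately show ?thesis
    using l by (simp add: thompson_le_iff mat_pow_PD assms log_ratio_unitary_diag_le[OF U] less_imp_neq[THEN not_sym]
      unitary_diag_PD[OF U])
qed

section \<open>Continuity of powers\<close>

lemma continuous_on_matrix_mult [continuous_intros]:
  fixes f :: "'a::topological_space \<Rightarrow> 'b::real_normed_algebra_1^'n^'m" and g :: "'a \<Rightarrow> 'b^'k^'n"
  assumes "continuous_on S f" "continuous_on S g"
  shows "continuous_on S (\<lambda>x. f x ** g x)"
  unfolding matrix_matrix_mult_def by (intro continuous_intros assms)

lemma continuous_on_matrix_vector_mult [continuous_intros]:
  fixes f :: "'a::topological_space \<Rightarrow> 'b::real_normed_algebra_1^'n^'m" and g :: "'a \<Rightarrow> 'b^'n"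
  assumes "continuous_on S f" "continuous_on S g"
  shows "continuous_on S (\<lambda>x. f x *v g x)"
  unfolding matrix_vector_mult_def by (intro continuous_intros assms)

lemma continuous_on_adjoint_mat [continuous_intros]:
  "continuous_on S f \<Longrightarrow> continuous_on S (\<lambda>x. adjoint_mat (f x))"
  unfolding adjoint_mat_def by (intro continuous_intros)

lemma continuous_on_diag_mat [continuous_intros]:
  assumes "\<And>i. continuous_on S (\<lambda>x. f x i)"
  shows "continuous_on S (\<lambda>x. diag_mat (f x))"
proof -
  have "continuous_on S (\<lambda>x. if i = j then complex_of_real (f x i) else 0)" for i j
    using assms by (cases "i = j") (auto intro!: continuous_intros)
  then show ?thesis unfolding diag_mat_def by (intro continuous_intros)
qed

text \<open>A continuous map from a compact set to a Hausdorff space is closed, so the preimage of a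
  closed set under \<open>f\<close> is the image under \<open>p\<close> of a closed set. Continuity
  of \<open>f\<close> can thus be read off from \<open>q\<close> on the parameter space.\<close>

lemma continuous_on_factor:
  fixes p :: "'a::topological_space \<Rightarrow> 'b::t2_space" and q :: "'a \<Rightarrow> 'c::topological_space"
  assumes K: "compact K" "closed K" and p: "continuous_on K p" and q: "continuous_on K q"
    and f: "\<And>x. x \<in> K \<Longrightarrow> f (p x) = q x"
  shows "continuous_on (p ` K) f"
proof -
  have "closed (f -` B \<inter> p ` K)" if "closed B" for B
  proof -
    have "f -` B \<inter> p ` K = p ` (K \<inter> q -` B)" using f by auto
    moreover have "compact (K \<inter> (K \<inter> q -` B))"
      by (intro compact_Int_closed K continuous_closed_preimage q that)
    then have "compact (p ` (K \<inter> q -` B))"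
      by (intro compact_continuous_image continuous_on_subset[OF p]) (auto simp: Int_absorb1)
    ultimately show ?thesis by (simp add: compact_imp_closed)
  qed
  moreover have "closed (p ` K)"
    by (intro compact_imp_closed compact_continuous_image p K)
  ultimately show ?thesis by (simp add: continuous_on_closed_vimage)
qed

section \<open>Comparison of the matrix norm with the Thompson metric\<close>

lemma norm_le_entries:
  fixes A :: "'n::finite cmat"
  assumes "\<And>i j. norm (A $ i $ j) \<le> e"
  shows "norm A \<le> real CARD('n) * (real CARD('n) * e)"
proof -
  have "norm A \<le> (\<Sum>i\<in>UNIV. norm (A $ i))"
    unfolding norm_vec_def[of A] by (rule L2_set_le_sum) simp
  also have "\<dots> \<le> (\<Sum>i\<in>(UNIV::'n set). real CARD('n) * e)"
  proof (rule sum_mono)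
    fix i
    have "norm (A $ i) \<le> (\<Sum>j\<in>UNIV. norm (A $ i $ j))"
      unfolding norm_vec_def[of "A $ i"] by (rule L2_set_le_sum) simp
    also have "\<dots> \<le> (\<Sum>j\<in>(UNIV::'n set). e)" by (intro sum_mono assms)
    finally show "norm (A $ i) \<le> real CARD('n) * e" by simp
  qed
  finally show ?thesis by simp
qed

lemma norm_matrix_vector_mult_le: "norm (M *v x) \<le> norm M * norm x" for M :: "complex^'n^'m"
proof -
  have "norm ((M *v x) $ i) \<le> norm (M $ i) * norm x" for i
  proof -
    have "norm ((M *v x) $ i) \<le> (\<Sum>j\<in>UNIV. \<bar>norm (M $ i $ j)\<bar> * \<bar>norm (x $ j)\<bar>)"
      unfolding matrix_vector_mult_def by (simp add: norm_sum[THEN order_trans] norm_mult)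
    also have "\<dots> \<le> norm (M $ i) * norm x"
      unfolding norm_vec_def[of "M $ i"] norm_vec_def[of x] by (rule L2_set_mult_ineq)
    finally show ?thesis .
  qed
  then have "norm (M *v x) \<le> L2_set (\<lambda>i. norm (M $ i) * norm x) UNIV"
    unfolding norm_vec_def[of "M *v x"] by (intro L2_set_mono) auto
  also have "\<dots> = norm M * norm x"
    unfolding norm_vec_def[of M] by (simp add: L2_set_left_distrib)
  finally show ?thesis .
qed

lemma norm_unitary_nth_le:
  assumes "unitary_mat U" shows "norm (U $ i $ j) \<le> 1"
proof -
  have "of_real (\<Sum>k\<in>UNIV. (norm (U $ i $ k))\<^sup>2) = (U ** adjoint_mat U) $ i $ i"
    by (simp add: matrix_matrix_mult_def adjoint_mat_def complex_norm_square[symmetric] del: of_real_power)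
  also have "\<dots> = of_real 1" by (simp add: unitary_matD[OF assms] mat_def)
  finally have "(\<Sum>k\<in>UNIV. (norm (U $ i $ k))\<^sup>2) = 1" by (simp only: of_real_eq_iff)
  moreover have "(norm (U $ i $ j))\<^sup>2 \<le> (\<Sum>k\<in>UNIV. (norm (U $ i $ k))\<^sup>2)"
    by (rule member_le_sum) auto
  ultimately show ?thesis by (simp add: power_le_one_iff abs_square_le_1)
qed

lemma compact_unitary: "compact {U :: 'n::finite cmat. unitary_mat U}"
  unfolding compact_eq_bounded_closed
proof
  show "bounded {U :: 'n cmat. unitary_mat U}"
    using norm_le_entries[OF norm_unitary_nth_le] by (auto simp: bounded_iff)
  show "closed {U :: 'n cmat. unitary_mat U}"
    unfolding unitary_mat_def by (intro closed_Collect_eq continuous_intros)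
qed

text \<open>Eigenvalues are values of the form at unit vectors, hence at most \<open>e\<close> in
  modulus, and entries of a unitary matrix are at most 1. One dimension factor comes from the sum
  over eigenvalues, the other two from the sum over entries.\<close>

lemma hermitian_norm_le:
  fixes H :: "'n::finite cmat"
  assumes "hermitian_mat H" and e: "\<And>x. x \<bullet> x = 1 \<Longrightarrow> \<bar>x \<bullet> (H *v x)\<bar> \<le> e"
  shows "norm H \<le> real CARD('n) * (real CARD('n) * (real CARD('n) * e))"
proof (rule norm_le_entries)
  fix i j
  obtain U l where U: "unitary_mat U" and H: "H = U ** diag_mat l ** adjoint_mat U"
    using hermitian_spectral[OF assms(1)] .
  have l: "\<bar>l k\<bar> \<le> e" for k
  proof -
    obtain x where "x \<bullet> x = 1" "x \<bullet> (H *v x) = l k"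
      unfolding H using unitary_eigenvector[OF U] by metis
    then show ?thesis using e by metis
  qed
  have "norm (H $ i $ j) = norm (\<Sum>k\<in>UNIV. U $ i $ k * of_real (l k) * cnj (U $ j $ k))"
    unfolding H by (subst matrix_matrix_mult_def) (simp add: diag_mat_mult_right_nth adjoint_mat_def)
  also have "\<dots> \<le> (\<Sum>k\<in>(UNIV::'n set). e)"
  proof (intro sum_norm_le)
    fix k
    have "norm (U $ i $ k * of_real (l k) * cnj (U $ j $ k)) = norm (U $ i $ k) * \<bar>l k\<bar> * norm (U $ j $ k)"
      by (simp add: norm_mult)
    also have "\<dots> \<le> 1 * e * 1"
      using l[of k] norm_unitary_nth_le[OF U] by (intro mult_mono mult_nonneg_nonneg) auto
    finally show "norm (U $ i $ k * of_real (l k) * cnj (U $ j $ k)) \<le> e" by simp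
  qed
  finally show "norm (H $ i $ j) \<le> real CARD('n) * e" by simp
qed

text \<open>At a unit vector the forms differ by at most the fraction \<open>exp c - 1\<close> of
  the form of \<open>A\<close>, which is at most \<open>exp R\<close> on the ball. The cube of the
  dimension is the constant of \<open>hermitian_norm_le\<close>.\<close>

lemma norm_diff_le_thompson:
  fixes A :: "'n::finite cmat"
  assumes A: "A \<in> PD" and B: "B \<in> PD" and R: "thompson (mat 1) A \<le> R" and c: "thompson A B \<le> c"
  shows "norm (B - A) \<le> real CARD('n) ^ 3 * (exp R * (exp c - 1))"
proof -
  have "\<bar>x \<bullet> ((B - A) *v x)\<bar> \<le> exp R * (exp c - 1)" if x: "x \<bullet> x = 1" for x
  proof -
    have "x \<noteq> 0" using x by auto
    have c0: "0 \<le> c" using thompson_nonneg[OF A B] c by simp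
    let ?a = "x \<bullet> (A *v x)" and ?b = "x \<bullet> (B *v x)"
    have "log_ratio (mat 1) A x \<le> R" "log_ratio A B x \<le> c"
      using assms one_PD \<open>x \<noteq> 0\<close> thompson_le_iff by blast+
    then have a: "?a \<le> exp R" and b: "?b \<le> exp c * ?a" and ab: "?a \<le> exp c * ?b"
      using x by (simp_all add: log_ratio_le_iff one_PD A B \<open>x \<noteq> 0\<close>)
    \<comment> \<open>The bound \<open>ab\<close> controls the difference by a multiple of
      \<open>?b\<close>. When \<open>?b\<close> is the smaller form it may be replaced by
      \<open>?a\<close>; otherwise the left side is negative.\<close>
    have "?a - ?b \<le> (exp c - 1) * ?a"
    proof (cases "?b \<le> ?a")
      case True
      then have "(exp c - 1) * ?b \<le> (exp c - 1) * ?a" using c0 by (intro mult_left_mono) auto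
      then show ?thesis using ab by (simp add: algebra_simps)
    next
      case False
      moreover have "0 \<le> (exp c - 1) * ?a"
        using A c0 \<open>x \<noteq> 0\<close> by (intro mult_nonneg_nonneg) (auto simp: PD_iff less_imp_le)
      ultimately show ?thesis by simp
    qed
    then have "\<bar>?b - ?a\<bar> \<le> (exp c - 1) * ?a" using b by (simp add: algebra_simps)
    also have "\<dots> \<le> (exp c - 1) * exp R" using a c0 by (intro mult_left_mono) auto
    finally show ?thesis
      by (simp add: matrix_vector_mult_diff_rdistrib inner_diff_right mult.commute)
  qed
  moreover have "hermitian_mat (B - A)"
    using A B by (simp add: PD_iff hermitian_mat_def adjoint_mat_def vec_eq_iff)
  ultimately show ?thesis
    using hermitian_norm_le by (fastforce simp: power3_eq_cube mult.assoc)
qed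

text \<open>Here the radius serves as a lower bound: both forms are at least
  \<open>exp (- R)\<close> times \<open>x \<bullet> x\<close>, so a difference that is small in norm
  is small relative to either form.\<close>

lemma thompson_le_norm_diff:
  assumes A: "A \<in> PD" "thompson (mat 1) A \<le> R" and B: "B \<in> PD" "thompson (mat 1) B \<le> R"
    and d: "norm (B - A) \<le> exp (- R) * (exp c - 1)"
  shows "thompson A B \<le> c"
  unfolding thompson_le_iff[OF A(1) B(1)]
proof safe
  fix x :: "complex^'a" assume x: "x \<noteq> 0"
  let ?a = "x \<bullet> (A *v x)" and ?b = "x \<bullet> (B *v x)"
  have "log_ratio (mat 1) A x \<le> R" "log_ratio (mat 1) B x \<le> R"
    using assms one_PD x thompson_le_iff by blast+
  then have a: "x \<bullet> x \<le> exp R * ?a" and b: "x \<bullet> x \<le> exp R * ?b"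
    by (simp_all add: log_ratio_le_iff one_PD A B x)
  have "\<bar>x \<bullet> ((B - A) *v x)\<bar> \<le> norm x * norm ((B - A) *v x)" by (rule Cauchy_Schwarz_ineq2)
  also have "\<dots> \<le> norm x * (norm (B - A) * norm x)"
    by (intro mult_left_mono norm_matrix_vector_mult_le) auto
  also have "\<dots> = norm (B - A) * (x \<bullet> x)" by (simp add: power2_norm_eq_inner[symmetric] power2_eq_square)
  also have "\<dots> \<le> (exp (- R) * (exp c - 1)) * (x \<bullet> x)" using d by (intro mult_right_mono) auto
  finally have ab: "\<bar>?b - ?a\<bar> \<le> (exp c - 1) * (exp (- R) * (x \<bullet> x))"
    by (simp add: matrix_vector_mult_diff_rdistrib inner_diff_right mult_ac)
  \<comment> \<open>The sign of \<open>c\<close> is not assumed. Since a norm is nonnegative,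
    \<open>d\<close> forces \<open>exp c - 1\<close> to be nonnegative.\<close>
  have "0 \<le> exp (- R) * (exp c - 1)" using d norm_ge_zero[of "B - A"] by (rule order_trans[rotated])
  then have c: "0 \<le> exp c - 1" by (simp add: zero_le_mult_iff)
  have "exp (- R) * (x \<bullet> x) \<le> ?a" "exp (- R) * (x \<bullet> x) \<le> ?b"
    using a b by (simp_all add: exp_minus field_simps)
  then have "\<bar>?b - ?a\<bar> \<le> (exp c - 1) * ?a" "\<bar>?b - ?a\<bar> \<le> (exp c - 1) * ?b"
    using ab c by (meson order_trans mult_left_mono)+
  then show "log_ratio A B x \<le> c"
    by (simp add: log_ratio_le_iff A B x algebra_simps) linarith
qed

section \<open>Compact balls and the power map on them\<close>

definition thompson_ball :: "real \<Rightarrow> 'n::finite cmat set" where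
  "thompson_ball R = {A \<in> PD. thompson (mat 1) A \<le> R}"

text \<open>The identity is diagonal in every eigenbasis, so the radius bounds exactly the
  logarithms of the eigenvalues. The ball becomes the image of a compact parameter set, which serves
  both its compactness and the continuity of powers.\<close>

lemma thompson_ball_eq:
  "thompson_ball R = (\<lambda>(U, l). U ** diag_mat (\<lambda>i. l $ i) ** adjoint_mat U) `
    ({U. unitary_mat U} \<times> cbox (\<chi> i. exp (- R)) (\<chi> i. exp R))"
proof (intro equalityI subsetI)
  fix A :: "'a cmat" assume "A \<in> thompson_ball R"
  then have A: "A \<in> PD" and R: "thompson (mat 1) A \<le> R" by (auto simp: thompson_ball_def)
  obtain U l where U: "unitary_mat U" and l: "\<And>i. 0 < l i" and Al: "A = U ** diag_mat l ** adjoint_mat U"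
    using PD_spectral[OF A] by metis
  have "\<bar>ln (l i)\<bar> \<le> R" for i
    by (rule ln_eigenvalue_le[OF U]) (use A R one_PD Al thompson_le_iff in blast)
  then have "exp (- R) \<le> l i \<and> l i \<le> exp R" for i
    using l[of i] by (metis abs_le_iff exp_le_cancel_iff exp_ln minus_le_iff)
  then have "(\<chi> i. l i) \<in> cbox (\<chi> i. exp (- R)) (\<chi> i. exp R)" by (simp add: mem_box_cart)
  moreover have eta: "($) (\<chi> i. l i) = l" by (rule ext) simp
  ultimately show "A \<in> (\<lambda>(U, l). U ** diag_mat (\<lambda>i. l $ i) ** adjoint_mat U) `
    ({U. unitary_mat U} \<times> cbox (\<chi> i. exp (- R)) (\<chi> i. exp R))"
    using U eta by (intro image_eqI[of _ _ "(U, \<chi> i. l i)"]) (auto simp: Al)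
next
  fix A :: "'a cmat" assume "A \<in> (\<lambda>(U, l). U ** diag_mat (\<lambda>i. l $ i) ** adjoint_mat U) `
    ({U. unitary_mat U} \<times> cbox (\<chi> i. exp (- R)) (\<chi> i. exp R))"
  then obtain U l where U: "unitary_mat U" and A: "A = U ** diag_mat (\<lambda>i. l $ i) ** adjoint_mat U"
    and l: "\<And>i. exp (- R) \<le> l $ i" "\<And>i. l $ i \<le> exp R"
    by (auto simp: mem_box_cart)
  have pos: "0 < l $ i" for i using l(1)[of i] by (meson exp_gt_zero less_le_trans)
  have "ln (l $ i) \<le> R" "- R \<le> ln (l $ i)" for i
    using l[of i] pos[of i] by (metis exp_le_cancel_iff exp_ln)+
  then have "\<bar>ln (l $ i)\<bar> \<le> R" for i by (metis abs_le_iff minus_le_iff)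
  then have "log_ratio (mat 1) A x \<le> R" if "x \<noteq> 0" for x
    using log_ratio_unitary_diag_le[OF U, of "\<lambda>_. 1" "\<lambda>i. l $ i" x R] pos that
    by (simp add: A diag_mat_one unitary_matD[OF U])
  moreover have "A \<in> PD" unfolding A using U pos by (rule unitary_diag_PD)
  ultimately show "A \<in> thompson_ball R" by (simp add: thompson_ball_def thompson_le_iff one_PD)
qed

lemma compact_spectral_box:
  "compact ({U :: 'n::finite cmat. unitary_mat U} \<times> cbox (\<chi> i. exp (- R)) (\<chi> i. exp R :: real ^ 'n))"
  by (intro compact_Times compact_unitary compact_cbox)

lemma compact_thompson_ball: "compact (thompson_ball R)"
  unfolding thompson_ball_eq case_prod_beta
  by (intro compact_continuous_image compact_spectral_box continuous_intros) 

text \<open>The power map factors through the compact space of pairs (eigenbasis, eigenvalues), on which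
  it is visibly continuous; no choice of eigenbasis depending continuously on the matrix is needed.\<close>

lemma continuous_on_mat_pow:
  "continuous_on (thompson_ball R \<times> {-T..T}) (\<lambda>(A, t). mat_pow A t)"
proof -
  define \<phi> where "\<phi> = (\<lambda>(U :: 'a cmat, l :: real^'a). U ** diag_mat (\<lambda>i. l $ i) ** adjoint_mat U)"
  let ?Z = "{U :: 'a cmat. unitary_mat U} \<times> cbox (\<chi> i. exp (- R)) (\<chi> i. exp R :: real ^ 'a)"
  let ?K = "?Z \<times> {-T..T}"
  let ?p = "\<lambda>(z, t). (\<phi> z, t)"
  let ?q = "\<lambda>((U, l), t). U ** diag_mat (\<lambda>i. l $ i powr t) ** adjoint_mat U"
  have K: "compact ?K" by (intro compact_Times[OF compact_spectral_box] compact_Icc)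
  have pos: "l $ i \<noteq> 0" if "l \<in> cbox (\<chi> i. exp (- R)) (\<chi> i. exp R)" for l :: "real^'a" and i
  proof -
    have "exp (- R) \<le> l $ i" using that by (simp add: mem_box_cart)
    then show ?thesis using exp_gt_zero[of "- R"] by linarith
  qed
  have "continuous_on (?p ` ?K) (\<lambda>(A, t). mat_pow A t)"
  proof (rule continuous_on_factor[where q = ?q])
    show "continuous_on ?K ?p" "continuous_on ?K ?q"
      using pos by (auto simp: case_prod_beta \<phi>_def intro!: continuous_intros)
  qed (use K in \<open>auto simp: compact_imp_closed \<phi>_def mat_pow_unitary_diag\<close>)
  moreover have "?p ` ?K = thompson_ball R \<times> {-T..T}"
    unfolding thompson_ball_eq \<phi>_def by force
  ultimately show ?thesis by simp
qed

text \<open>Small Thompson distance gives small norm distance, uniform continuity on a compact set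
  handles the powers in norm, and the way back uses a ball that contains the powers, of radius
  \<open>T * R\<close>.\<close>

lemma thompson_mat_pow_uniform:
  fixes R T \<epsilon> :: real
  assumes "0 < \<epsilon>" "0 \<le> R" "0 \<le> T"
  obtains \<eta> where "0 < \<eta>"
    "\<And>(A :: 'n::finite cmat) B s t. A \<in> thompson_ball R \<Longrightarrow> B \<in> thompson_ball R \<Longrightarrow>
      \<bar>s\<bar> \<le> T \<Longrightarrow> \<bar>t\<bar> \<le> T \<Longrightarrow> \<bar>s - t\<bar> < \<eta> \<Longrightarrow> thompson A B < \<eta> \<Longrightarrow>
      thompson (mat_pow A s) (mat_pow B t) \<le> \<epsilon>"
proof -
  \<comment> \<open>The norm tolerance from which \<open>thompson_le_norm_diff\<close> concludes
    with \<epsilon> on the ball of radius \<open>T * R\<close>.\<close>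
  define e where "e = exp (- (T * R)) * (exp \<epsilon> - 1)"
  have "0 < e" using assms by (simp add: e_def)
  have "uniformly_continuous_on (thompson_ball R \<times> {-T..T} :: ('n cmat \<times> real) set) (\<lambda>(A, t). mat_pow A t)"
    by (intro compact_uniformly_continuous continuous_on_mat_pow compact_Times compact_thompson_ball compact_Icc)
  then obtain d where "0 < d" and d: "\<And>(A :: 'n cmat) B s t. A \<in> thompson_ball R \<Longrightarrow> B \<in> thompson_ball R \<Longrightarrow>
      s \<in> {-T..T} \<Longrightarrow> t \<in> {-T..T} \<Longrightarrow> dist (A, s) (B, t) < d \<Longrightarrow> dist (mat_pow A s) (mat_pow B t) < e"
    using \<open>0 < e\<close> unfolding uniformly_continuous_on_def by (fastforce simp: dist_commute)
  let ?n = "real CARD('n)"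
  have "((\<lambda>x. ?n ^ 3 * (exp R * (exp x - 1))) \<longlongrightarrow> ?n ^ 3 * (exp R * (exp 0 - 1))) (at_right 0)"
    by (intro tendsto_intros)
  then have "eventually (\<lambda>x. ?n ^ 3 * (exp R * (exp x - 1)) < d / 2) (at_right 0)"
    using \<open>0 < d\<close> by (intro order_tendstoD) auto
  then obtain b where b: "0 < b" "\<And>x. 0 < x \<Longrightarrow> x < b \<Longrightarrow> ?n ^ 3 * (exp R * (exp x - 1)) < d / 2"
    by (auto simp: eventually_at_right_field)
  \<comment> \<open>\<open>b / 2\<close> lies strictly inside the range of validity of
    \<open>b\<close>. The two halves of \<open>d\<close> are spent on the matrix and on the
    exponent.\<close>
  define \<eta> where "\<eta> = min (b / 2) (d / 2)"
  show thesis
  proof (rule that)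
    show "0 < \<eta>" using b \<open>0 < d\<close> by (simp add: \<eta>_def)
    fix A B :: "'n cmat" and s t
    assume A: "A \<in> thompson_ball R" and B: "B \<in> thompson_ball R" and s: "\<bar>s\<bar> \<le> T" and t: "\<bar>t\<bar> \<le> T"
      and st: "\<bar>s - t\<bar> < \<eta>" and AB: "thompson A B < \<eta>"
    have PD: "A \<in> PD" "B \<in> PD" and le: "thompson (mat 1) A \<le> R" "thompson (mat 1) B \<le> R"
      using A B by (auto simp: thompson_ball_def)
    have "norm (B - A) \<le> ?n ^ 3 * (exp R * (exp (b / 2) - 1))"
      using AB by (intro norm_diff_le_thompson PD le) (simp add: \<eta>_def)
    also have "\<dots> < d / 2" using b by simp
    finally have "norm (B - A) < d / 2" .
    moreover have "dist (A, s) (B, t) \<le> norm (B - A) + \<bar>s - t\<bar>"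
      using norm_Pair_le[of "A - B" "s - t"] by (simp add: dist_norm norm_minus_commute)
    ultimately have "dist (A, s) (B, t) < d" using st by (simp add: \<eta>_def)
    then have close: "norm (mat_pow B t - mat_pow A s) \<le> e"
      using d[OF A B, of s t] s t by (simp add: less_imp_le dist_norm norm_minus_commute abs_le_iff minus_le_iff)
    have bound: "thompson (mat 1) (mat_pow C r) \<le> T * R"
      if "C \<in> PD" "thompson (mat 1) C \<le> R" "\<bar>r\<bar> \<le> T" for C :: "'n cmat" and r
      using thompson_mat_pow[OF that(1), of 0 r] that mult_mono[of "\<bar>r\<bar>" T "thompson (mat 1) C" R] assms
      by (simp add: mat_pow_0 thompson_nonneg one_PD)
    show "thompson (mat_pow A s) (mat_pow B t) \<le> \<epsilon>"
      by (rule thompson_le_norm_diff[OF mat_pow_PD[OF PD(1)] bound[OF PD(1) le(1) s]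
        mat_pow_PD[OF PD(2)] bound[OF PD(2) le(2) t] close[unfolded e_def]])
  qed
qed

section \<open>Geodesics\<close>

lemma geo_PD:
  assumes "X \<in> PD" "A \<in> PD" shows "geo X t A \<in> PD"
  unfolding geo_def by (intro mat_pow_conj_PD mat_pow_PD assms)

lemma geo_zero: "X \<in> PD \<Longrightarrow> A \<in> PD \<Longrightarrow> geo X 0 A = X"
  by (simp add: geo_def mat_pow_0 mat_pow_conj_PD mat_pow_add mat_pow_1)

text \<open>The outer square roots cancel, so in whitened coordinates \<open>geo X t\<close> is the
  power map. The composition law for parameters is then the law for powers of powers.\<close>

lemma whiten_geo:
  assumes "X \<in> PD"
  shows "mat_pow X (-1/2) ** geo X t A ** mat_pow X (-1/2)
    = mat_pow (mat_pow X (-1/2) ** A ** mat_pow X (-1/2)) t"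
proof -
  let ?P = "mat_pow (mat_pow X (-1/2) ** A ** mat_pow X (-1/2)) t"
  have "mat_pow X (-1/2) ** geo X t A ** mat_pow X (-1/2)
      = (mat_pow X (- (1/2)) ** mat_pow X (1/2)) ** ?P ** (mat_pow X (1/2) ** mat_pow X (- (1/2)))"
    by (simp add: geo_def matrix_mul_assoc)
  then show ?thesis by (simp only: mat_pow_minus[OF assms] matrix_mul_lid matrix_mul_rid)
qed

lemma geo_geo:
  assumes "X \<in> PD" "A \<in> PD"
  shows "geo X s (geo X t A) = geo X (t * s) A"
  unfolding geo_def[of X s] whiten_geo[OF assms(1)] mat_pow_mat_pow[OF mat_pow_conj_PD[OF assms]]
  by (simp add: geo_def)

lemma thompson_mat_pow_conj:
  assumes "X \<in> PD"
  shows "thompson (mat_pow X r ** A ** mat_pow X r) (mat_pow X r ** B ** mat_pow X r) = thompson A B"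
  using thompson_conj[OF invertible_mat_pow[OF assms, of r]] adjoint_mat_pow[OF assms, of r] by simp

lemma thompson_whiten:
  assumes "X \<in> PD"
  shows "thompson (mat 1) (mat_pow X (-1/2) ** A ** mat_pow X (-1/2)) = thompson X A"
  using thompson_mat_pow_conj[OF assms, of "-1/2" X A] by (simp only: whitening[OF assms])

lemma thompson_geo_geo:
  assumes "X \<in> PD"
  shows "thompson (geo X s A) (geo X t B) =
    thompson (mat_pow (mat_pow X (-1/2) ** A ** mat_pow X (-1/2)) s)
      (mat_pow (mat_pow X (-1/2) ** B ** mat_pow X (-1/2)) t)"
  unfolding geo_def by (rule thompson_mat_pow_conj[OF assms])

lemma thompson_geo_same:
  assumes "X \<in> PD" "A \<in> PD"
  shows "thompson (geo X s A) (geo X t A) \<le> \<bar>s - t\<bar> * thompson X A"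
  using thompson_mat_pow[OF mat_pow_conj_PD[OF assms, of "-1/2"], of s t]
  unfolding thompson_geo_geo[OF assms(1)] thompson_whiten[OF assms(1)] by (simp only: abs_minus_commute)

lemma thompson_geo_self: "X \<in> PD \<Longrightarrow> A \<in> PD \<Longrightarrow> thompson X (geo X t A) \<le> \<bar>t\<bar> * thompson X A"
  using thompson_geo_same[of X A 0 t] by (simp add: geo_zero)

text \<open>The route passes through \<open>X\<close>. The bound is crude but linear in the
  distances to \<open>X\<close>, hence integrable under measures in \<open>P1\<close>; it serves
  where uniform continuity gives no information.\<close>

lemma thompson_geo_le:
  assumes "X \<in> PD" "A \<in> PD" "B \<in> PD"
  shows "thompson (geo X s A) (geo X t B) \<le> \<bar>s\<bar> * thompson X A + \<bar>t\<bar> * thompson X B"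
proof -
  have "thompson (geo X s A) (geo X t B) \<le> thompson (geo X s A) X + thompson X (geo X t B)"
    by (intro thompson_triangle geo_PD assms)
  then show ?thesis
    using thompson_geo_self[OF assms(1,2), of s] thompson_geo_self[OF assms(1,3), of t]
    by (simp add: thompson_commute[of _ X])
qed

lemma thompson_geo_uniform:
  fixes X :: "'n::finite cmat"
  assumes X: "X \<in> PD" and "0 < \<epsilon>" "0 \<le> R" "0 \<le> T"
  obtains \<eta> where "0 < \<eta>"
    "\<And>A B s t. A \<in> PD \<Longrightarrow> B \<in> PD \<Longrightarrow> thompson X A \<le> R \<Longrightarrow> thompson X B \<le> R \<Longrightarrow>
      \<bar>s\<bar> \<le> T \<Longrightarrow> \<bar>t\<bar> \<le> T \<Longrightarrow> \<bar>s - t\<bar> < \<eta> \<Longrightarrow> thompson A B < \<eta> \<Longrightarrow>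
      thompson (geo X s A) (geo X t B) \<le> \<epsilon>"
proof -
  obtain \<eta> where "0 < \<eta>"
    and \<eta>: "\<And>(A :: 'n cmat) B s t. A \<in> thompson_ball R \<Longrightarrow> B \<in> thompson_ball R \<Longrightarrow>
      \<bar>s\<bar> \<le> T \<Longrightarrow> \<bar>t\<bar> \<le> T \<Longrightarrow> \<bar>s - t\<bar> < \<eta> \<Longrightarrow> thompson A B < \<eta> \<Longrightarrow>
      thompson (mat_pow A s) (mat_pow B t) \<le> \<epsilon>"
    using thompson_mat_pow_uniform[OF assms(2-4), where 'n = 'n] by metis
  show thesis
  proof (rule that[OF \<open>0 < \<eta>\<close>])
    fix A B :: "'n cmat" and s t
    assume *: "A \<in> PD" "B \<in> PD" "thompson X A \<le> R" "thompson X B \<le> R"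
      "\<bar>s\<bar> \<le> T" "\<bar>t\<bar> \<le> T" "\<bar>s - t\<bar> < \<eta>" "thompson A B < \<eta>"
    then have "mat_pow X (-1/2) ** A ** mat_pow X (-1/2) \<in> thompson_ball R"
      "mat_pow X (-1/2) ** B ** mat_pow X (-1/2) \<in> thompson_ball R"
      unfolding thompson_ball_def mem_Collect_eq thompson_whiten[OF X]
      by (auto simp: X mat_pow_conj_PD simp del: divide_minus_left)
    moreover have "thompson (mat_pow X (-1/2) ** A ** mat_pow X (-1/2)) (mat_pow X (-1/2) ** B ** mat_pow X (-1/2)) < \<eta>"
      using * unfolding thompson_mat_pow_conj[OF X] by simp
    ultimately show "thompson (geo X s A) (geo X t B) \<le> \<epsilon>"
      unfolding thompson_geo_geo[OF X] using * \<eta> by blast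
  qed
qed

section \<open>Borel measurability on the positive definite cone\<close>

lemma space_PDborel [simp]: "space PDborel = PD"
  by (simp add: PDborel_def space_restrict_space)

text \<open>A countable exhaustion by compact sets: it makes \<open>PD\<close> a Borel set and lets
  measurability of powers be checked ball by ball, where they are continuous.\<close>

lemma PD_UN_thompson_ball: "PD = (\<Union>n. thompson_ball (real n))"
  by (auto simp: thompson_ball_def real_arch_simple)

lemma thompson_ball_borel: "thompson_ball R \<in> sets borel"
  by (intro borel_closed compact_imp_closed compact_thompson_ball)

lemma PD_borel: "PD \<in> sets borel"
  unfolding PD_UN_thompson_ball using thompson_ball_borel by (intro sets.countable_UN) auto

lemma measurable_mat_pow: "(\<lambda>A. mat_pow A t) \<in> PDborel \<rightarrow>\<^sub>M PDborel"
proof -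
  have "(\<lambda>A :: 'a cmat. mat_pow A t) \<in> borel_measurable PDborel"
  proof (rule measurable_piecewise_restrict)
    show "countable (range (\<lambda>n. thompson_ball (real n) :: 'a cmat set))" by simp
    show "space PDborel \<subseteq> \<Union> (range (\<lambda>n. thompson_ball (real n) :: 'a cmat set))"
      by (simp flip: PD_UN_thompson_ball)
  next
    fix \<Omega> :: "'a cmat set"
    assume "\<Omega> \<in> range (\<lambda>n. thompson_ball (real n))"
    then obtain n where \<Omega>: "\<Omega> = thompson_ball (real n)" by auto
    have sub: "\<Omega> \<subseteq> PD" by (auto simp: \<Omega> thompson_ball_def)
    have b: "\<Omega> \<in> sets borel" unfolding \<Omega> by (rule thompson_ball_borel)
    show "\<Omega> \<inter> space PDborel \<in> sets PDborel"
      using sub b by (simp add: PD_borel PDborel_def space_restrict_space sets_restrict_space_iff Int_absorb2)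
    have "continuous_on \<Omega> (\<lambda>A. (\<lambda>(A, t). mat_pow A t) (A, t))"
      unfolding \<Omega> by (rule continuous_on_compose2[OF continuous_on_mat_pow[of _ "\<bar>t\<bar>"]])
        (auto intro!: continuous_intros)
    then have "(\<lambda>A. mat_pow A t) \<in> borel_measurable (restrict_space borel \<Omega>)"
      by (intro borel_measurable_continuous_on_restrict) simp
    moreover have "restrict_space PDborel \<Omega> = restrict_space borel \<Omega>"
      using b sub by (simp add: PD_borel PDborel_def restrict_restrict_space Int_absorb1)
    ultimately show "(\<lambda>A. mat_pow A t) \<in> borel_measurable (restrict_space PDborel \<Omega>)" by simp
  qed
  then show ?thesis
    unfolding PDborel_def[where 'n = 'a] by (intro measurable_restrict_space2) (auto simp: space_restrict_space mat_pow_PD)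
qed

lemma measurable_mat_pow_conj:
  assumes "X \<in> PD"
  shows "(\<lambda>A. mat_pow X r ** A ** mat_pow X r) \<in> PDborel \<rightarrow>\<^sub>M PDborel"
proof -
  have "(\<lambda>A. mat_pow X r ** A ** mat_pow X r) \<in> borel \<rightarrow>\<^sub>M borel"
    by (intro borel_measurable_continuous_onI continuous_intros)
  then show ?thesis
    unfolding PDborel_def
    by (intro measurable_restrict_space2 measurable_restrict_space1)
      (auto simp: space_restrict_space mat_pow_conj_PD assms)
qed

lemma measurable_geo [measurable]:
  assumes "X \<in> PD" shows "geo X t \<in> PDborel \<rightarrow>\<^sub>M PDborel"
proof -
  have "(\<lambda>A. mat_pow X (1/2) ** mat_pow (mat_pow X (-1/2) ** A ** mat_pow X (-1/2)) t ** mat_pow X (1/2)) \<in> PDborel \<rightarrow>\<^sub>M PDborel"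
    by (rule measurable_compose[OF measurable_compose[OF measurable_mat_pow_conj[OF assms] measurable_mat_pow]
      measurable_mat_pow_conj[OF assms]])
  then show ?thesis by (simp add: geo_def[abs_def])
qed

text \<open>The supremum runs over uncountably many vectors, but a sublevel set is cut out by
  conditions closed in the pair of matrices, hence is the preimage of one closed set.\<close>

lemma measurable_thompson [measurable]:
  fixes f :: "'a \<Rightarrow> 'n::finite cmat"
  assumes f: "f \<in> M \<rightarrow>\<^sub>M PDborel" and g: "g \<in> M \<rightarrow>\<^sub>M PDborel"
  shows "(\<lambda>x. thompson (f x) (g x)) \<in> borel_measurable M"
proof -
  have "{w \<in> space M. thompson (f w) (g w) \<le> c} \<in> sets M" for c
  proof -
    define S where "S = {p :: 'n cmat \<times> 'n cmat. \<forall>x. x \<noteq> 0 \<longrightarrow>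
      x \<bullet> (snd p *v x) \<le> exp c * (x \<bullet> (fst p *v x)) \<and> x \<bullet> (fst p *v x) \<le> exp c * (x \<bullet> (snd p *v x))}"
    have "closed S"
      unfolding S_def
      by (intro closed_Collect_all closed_Collect_imp closed_Collect_conj closed_Collect_le
        open_Collect_const continuous_intros)
    have "f \<in> borel_measurable M" "g \<in> borel_measurable M"
      using f g unfolding PDborel_def by (auto simp: measurable_restrict_space2_iff)
    then have "(\<lambda>x. (f x, g x)) \<in> borel_measurable M" by (rule borel_measurable_Pair)
    then have "(\<lambda>x. (f x, g x)) -` S \<inter> space M \<in> sets M"
      using \<open>closed S\<close> by (intro measurable_sets) auto
    moreover have "f w \<in> PD" "g w \<in> PD" if "w \<in> space M" for w
      using measurable_space[OF f that] measurable_space[OF g that] by auto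
    then have "(\<lambda>x. (f x, g x)) -` S \<inter> space M = {w \<in> space M. thompson (f w) (g w) \<le> c}"
      by (auto simp: S_def thompson_le_iff log_ratio_le_iff)
    ultimately show ?thesis by simp
  qed
  then show ?thesis by (simp add: borel_measurable_iff_le)
qed

section \<open>Transport along geodesics\<close>

lemma P1_D:
  assumes "\<mu> \<in> P1"
  shows "prob_space \<mu>" "sets \<mu> = sets PDborel" "space \<mu> = PD"
proof -
  show "prob_space \<mu>" and sets: "sets \<mu> = sets PDborel"
    using assms by (auto simp: P1_def)
  show "space \<mu> = PD" using sets_eq_imp_space_eq[OF sets] by simp
qed

text \<open>\<open>P1\<close> provides some base point \<open>W\<close>. Moving it to
  \<open>X\<close> adds the constant \<open>thompson X W\<close>, which has finite integral because
  the total mass is 1.\<close>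

lemma nn_integral_thompson_finite:
  assumes \<mu>: "\<mu> \<in> P1" and X: "X \<in> PD"
  shows "(\<integral>\<^sup>+Z. ennreal (thompson X Z) \<partial>\<mu>) < \<infinity>"
proof -
  interpret prob_space \<mu> using P1_D(1)[OF \<mu>] .
  note [measurable_cong] = P1_D(2)[OF \<mu>]
  obtain W where W: "W \<in> PD" "(\<integral>\<^sup>+Z. ennreal (rdist Z W) \<partial>\<mu>) < \<infinity>"
    using \<mu> by (auto simp: P1_def)
  have [measurable]: "W \<in> space PDborel" "X \<in> space PDborel" using W X by simp_all
  have "(\<integral>\<^sup>+Z. ennreal (thompson X Z) \<partial>\<mu>) \<le> (\<integral>\<^sup>+Z. ennreal (thompson X W) + ennreal (thompson Z W) \<partial>\<mu>)"
  proof (rule nn_integral_mono)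
    fix Z assume "Z \<in> space \<mu>"
    then have Z: "Z \<in> PD" using P1_D[OF \<mu>] by simp
    then show "ennreal (thompson X Z) \<le> ennreal (thompson X W) + ennreal (thompson Z W)"
      using thompson_triangle[OF X W(1) Z] X W(1)
      by (simp add: thompson_nonneg thompson_commute[of W] ennreal_leI flip: ennreal_plus)
  qed
  also have "\<dots> = ennreal (thompson X W) + (\<integral>\<^sup>+Z. ennreal (thompson Z W) \<partial>\<mu>)"
    by (subst nn_integral_add) (auto simp: emeasure_space_1)
  also have "(\<integral>\<^sup>+Z. ennreal (thompson Z W) \<partial>\<mu>) \<le> (\<integral>\<^sup>+Z. ennreal (rdist Z W) \<partial>\<mu>)"
    using P1_D[OF \<mu>] W(1) by (intro nn_integral_mono ennreal_leI thompson_le_rdist) auto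
  finally show ?thesis using W(2) by (auto simp: less_top[symmetric] top_unique)
qed

text \<open>Monotonicity of \<open>nn_integral\<close> holds for arbitrary integrands, so the only
  measurability that enters is that of \<open>thompson\<close>.\<close>

lemma nn_integral_rdist_le:
  fixes \<pi> :: "'a measure" and f g :: "'a \<Rightarrow> 'n::finite cmat"
  assumes [measurable]: "f \<in> \<pi> \<rightarrow>\<^sub>M PDborel" "g \<in> \<pi> \<rightarrow>\<^sub>M PDborel"
  shows "(\<integral>\<^sup>+p. ennreal (rdist (f p) (g p)) \<partial>\<pi>)
    \<le> ennreal (sqrt (real CARD('n))) * (\<integral>\<^sup>+p. ennreal (thompson (f p) (g p)) \<partial>\<pi>)"
proof -
  have "(\<integral>\<^sup>+p. ennreal (rdist (f p) (g p)) \<partial>\<pi>)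
      \<le> (\<integral>\<^sup>+p. ennreal (sqrt (real CARD('n))) * ennreal (thompson (f p) (g p)) \<partial>\<pi>)"
  proof (rule nn_integral_mono)
    fix p assume "p \<in> space \<pi>"
    then have "f p \<in> PD" "g p \<in> PD"
      using assms[THEN measurable_space] by auto
    then show "ennreal (rdist (f p) (g p)) \<le> ennreal (sqrt (real CARD('n))) * ennreal (thompson (f p) (g p))"
      by (simp add: rdist_le_thompson ennreal_leI flip: ennreal_mult')
  qed
  also have "\<dots> = ennreal (sqrt (real CARD('n))) * (\<integral>\<^sup>+p. ennreal (thompson (f p) (g p)) \<partial>\<pi>)"
    by (rule nn_integral_cmult) measurable
  finally show ?thesis .
qed

lemma P1_I:
  assumes "prob_space \<mu>" and sets [measurable_cong]: "sets \<mu> = sets PDborel"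
    and X: "X \<in> PD" and fin: "(\<integral>\<^sup>+Z. ennreal (thompson X Z) \<partial>\<mu>) < \<infinity>"
  shows "\<mu> \<in> P1"
proof -
  have "(\<integral>\<^sup>+Z. ennreal (rdist Z X) \<partial>\<mu>)
      \<le> ennreal (sqrt (real CARD('a))) * (\<integral>\<^sup>+Z. ennreal (thompson X Z) \<partial>\<mu>)"
    using nn_integral_rdist_le[of "\<lambda>Z. Z" \<mu> "\<lambda>_. X"] X by (simp add: thompson_commute)
  also have "\<dots> < \<infinity>" using fin by (simp add: ennreal_mult_less_top)
  finally show ?thesis using assms by (auto simp: P1_def)
qed

lemma measurable_geo_P1 [measurable]:
  "X \<in> PD \<Longrightarrow> sets M = sets PDborel \<Longrightarrow> geo X t \<in> M \<rightarrow>\<^sub>M PDborel"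
  using measurable_geo measurable_cong_sets by blast

lemma geo_push_P1:
  assumes X: "X \<in> PD" and \<mu>: "\<mu> \<in> P1" shows "geo_push X t \<mu> \<in> P1"
proof (rule P1_I[OF _ _ X])
  interpret prob_space \<mu> using P1_D(1)[OF \<mu>] .
  note [measurable_cong] = P1_D(2)[OF \<mu>]
  have [measurable]: "geo X t \<in> \<mu> \<rightarrow>\<^sub>M PDborel" "X \<in> space PDborel"
    using X P1_D(2)[OF \<mu>] by (auto intro: measurable_geo_P1)
  show "prob_space (geo_push X t \<mu>)"
    unfolding geo_push_def by (rule prob_space_distr) measurable
  show "sets (geo_push X t \<mu>) = sets PDborel" by (simp add: geo_push_def)
  have "(\<integral>\<^sup>+Z. ennreal (thompson X Z) \<partial>geo_push X t \<mu>) = (\<integral>\<^sup>+Z. ennreal (thompson X (geo X t Z)) \<partial>\<mu>)"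
    unfolding geo_push_def by (subst nn_integral_distr) auto
  also have "\<dots> \<le> (\<integral>\<^sup>+Z. ennreal \<bar>t\<bar> * ennreal (thompson X Z) \<partial>\<mu>)"
    using P1_D(3)[OF \<mu>] X
    by (intro nn_integral_mono) (auto simp: thompson_geo_self ennreal_leI simp flip: ennreal_mult')
  also have "\<dots> = ennreal \<bar>t\<bar> * (\<integral>\<^sup>+Z. ennreal (thompson X Z) \<partial>\<mu>)"
    by (rule nn_integral_cmult) measurable
  also have "\<dots> < \<infinity>"
    using nn_integral_thompson_finite[OF \<mu> X] by (simp add: ennreal_mult_less_top)
  finally show "(\<integral>\<^sup>+Z. ennreal (thompson X Z) \<partial>geo_push X t \<mu>) < \<infinity>" .
qed

section \<open>Couplings and their transport cost\<close>

lemma couplings_D: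
  assumes "\<pi> \<in> couplings \<mu> \<nu>"
  shows "prob_space \<pi>" "sets \<pi> = sets (PDborel \<Otimes>\<^sub>M PDborel)" "space \<pi> = PD \<times> PD"
    "distr \<pi> PDborel fst = \<mu>" "distr \<pi> PDborel snd = \<nu>"
proof -
  show *: "prob_space \<pi>" "sets \<pi> = sets (PDborel \<Otimes>\<^sub>M PDborel)"
    "distr \<pi> PDborel fst = \<mu>" "distr \<pi> PDborel snd = \<nu>"
    using assms by (auto simp: couplings_def)
  show "space \<pi> = PD \<times> PD"
    using sets_eq_imp_space_eq[OF *(2)] by (simp add: space_pair_measure)
qed

text \<open>Moving both coordinates of \<pi> along their geodesics yields a coupling of the images,
  whose cost bounds the infimum. Every estimate on \<open>W1\<close> between images reduces in this
  way to an integral over a coupling of the original measures.\<close>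

lemma W1_geo_push_le:
  fixes X :: "'n::finite cmat"
  assumes X: "X \<in> PD" and \<pi>: "\<pi> \<in> couplings \<nu> \<mu>" and "0 \<le> c"
    and c: "(\<integral>\<^sup>+p. ennreal (thompson (geo X s (fst p)) (geo X t (snd p))) \<partial>\<pi>) \<le> ennreal c"
  shows "W1 (geo_push X s \<nu>) (geo_push X t \<mu>) \<le> sqrt (real CARD('n)) * c"
proof -
  interpret prob_space \<pi> using couplings_D(1)[OF \<pi>] .
  note [measurable_cong] = couplings_D(2)[OF \<pi>]
  have [measurable]: "geo X r \<in> PDborel \<rightarrow>\<^sub>M PDborel" for r using X by measurable
  let ?g = "\<lambda>p. (geo X s (fst p), geo X t (snd p))"
  define \<rho> where "\<rho> = distr \<pi> (PDborel \<Otimes>\<^sub>M PDborel) ?g"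
  have "\<rho> \<in> couplings (geo_push X s \<nu>) (geo_push X t \<mu>)"
    unfolding couplings_def mem_Collect_eq
  proof (intro conjI)
    show "prob_space \<rho>" unfolding \<rho>_def by (rule prob_space_distr) measurable
    show "sets \<rho> = sets (PDborel \<Otimes>\<^sub>M PDborel)" by (simp add: \<rho>_def)
    show "distr \<rho> PDborel fst = geo_push X s \<nu>" "distr \<rho> PDborel snd = geo_push X t \<mu>"
      unfolding \<rho>_def geo_push_def couplings_D(4,5)[OF \<pi>, symmetric]
      by (auto simp: distr_distr comp_def)
  qed
  then have "(INF \<pi>\<in>couplings (geo_push X s \<nu>) (geo_push X t \<mu>). \<integral>\<^sup>+p. ennreal (rdist (fst p) (snd p)) \<partial>\<pi>)
      \<le> (\<integral>\<^sup>+p. ennreal (rdist (fst p) (snd p)) \<partial>\<rho>)"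
    by (rule INF_lower)
  also have "\<dots> \<le> ennreal (sqrt (real CARD('n))) * (\<integral>\<^sup>+p. ennreal (thompson (fst p) (snd p)) \<partial>\<rho>)"
    unfolding \<rho>_def by (rule nn_integral_rdist_le) measurable
  also have "(\<integral>\<^sup>+p. ennreal (thompson (fst p) (snd p)) \<partial>\<rho>)
      = (\<integral>\<^sup>+p. ennreal (thompson (geo X s (fst p)) (geo X t (snd p))) \<partial>\<pi>)"
    unfolding \<rho>_def by (subst nn_integral_distr) auto
  also have "\<dots> \<le> ennreal c" by (rule c)
  finally have "(INF \<pi>\<in>couplings (geo_push X s \<nu>) (geo_push X t \<mu>). \<integral>\<^sup>+p. ennreal (rdist (fst p) (snd p)) \<partial>\<pi>)
      \<le> ennreal (sqrt (real CARD('n)) * c)"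
    using \<open>0 \<le> c\<close> by (simp add: mult_left_mono ennreal_mult)
  then show ?thesis
    unfolding W1_def using \<open>0 \<le> c\<close> by (intro enn2real_leI) auto
qed

lemma diagonal_coupling:
  assumes \<mu>: "\<mu> \<in> P1"
  shows "distr \<mu> (PDborel \<Otimes>\<^sub>M PDborel) (\<lambda>x. (x, x)) \<in> couplings \<mu> \<mu>"
proof -
  interpret prob_space \<mu> using P1_D(1)[OF \<mu>] .
  note [measurable_cong] = P1_D(2)[OF \<mu>]
  have "distr \<mu> PDborel (\<lambda>x. x) = \<mu>" using P1_D(2)[OF \<mu>] by (intro distr_id2) simp
  then show ?thesis
    by (auto simp: couplings_def distr_distr comp_def intro!: prob_space_distr)
qed

lemma W1_geo_push_Lipschitz:
  assumes X: "X \<in> PD" and \<mu>: "\<mu> \<in> P1"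
  obtains C where "0 < C" "\<And>t s. W1 (geo_push X t \<mu>) (geo_push X s \<mu>) \<le> C * \<bar>t - s\<bar>"
proof -
  interpret prob_space \<mu> using P1_D(1)[OF \<mu>] .
  note [measurable_cong] = P1_D(2)[OF \<mu>]
  have [measurable]: "geo X r \<in> PDborel \<rightarrow>\<^sub>M PDborel" for r using X by measurable
  have [measurable]: "X \<in> space PDborel" using X by simp
  define m where "m = enn2real (\<integral>\<^sup>+Z. ennreal (thompson X Z) \<partial>\<mu>)"
  have m: "(\<integral>\<^sup>+Z. ennreal (thompson X Z) \<partial>\<mu>) = ennreal m"
    using nn_integral_thompson_finite[OF \<mu> X] unfolding m_def by (intro ennreal_enn2real[symmetric]) simp
  have m0: "0 \<le> m" by (simp add: m_def)
  let ?q = "sqrt (real CARD('a))"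
  \<comment> \<open>The geodesic to \<open>Z\<close> has speed at most \<open>thompson X Z\<close>,
    so \<open>m\<close> bounds the mean speed; \<open>?q\<close> converts to the Riemannian
    distance. The summand 1 keeps the constant positive when \<open>m\<close> is 0, as for the point
    mass at \<open>X\<close>.\<close>
  have "W1 (geo_push X t \<mu>) (geo_push X s \<mu>) \<le> (?q * m + 1) * \<bar>t - s\<bar>" for t s
  proof -
    have "(\<integral>\<^sup>+p. ennreal (thompson (geo X t (fst p)) (geo X s (snd p))) \<partial>distr \<mu> (PDborel \<Otimes>\<^sub>M PDborel) (\<lambda>x. (x, x)))
        = (\<integral>\<^sup>+Z. ennreal (thompson (geo X t Z) (geo X s Z)) \<partial>\<mu>)"
      by (subst nn_integral_distr) auto
    also have "\<dots> \<le> (\<integral>\<^sup>+Z. ennreal \<bar>t - s\<bar> * ennreal (thompson X Z) \<partial>\<mu>)"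
      using P1_D(3)[OF \<mu>] X
      by (intro nn_integral_mono) (auto simp: thompson_geo_same ennreal_leI simp flip: ennreal_mult')
    also have "\<dots> = ennreal \<bar>t - s\<bar> * (\<integral>\<^sup>+Z. ennreal (thompson X Z) \<partial>\<mu>)"
      by (rule nn_integral_cmult) measurable
    also have "\<dots> = ennreal (\<bar>t - s\<bar> * m)" by (simp add: m m0 ennreal_mult)
    finally have "W1 (geo_push X t \<mu>) (geo_push X s \<mu>) \<le> ?q * (\<bar>t - s\<bar> * m)"
      by (intro W1_geo_push_le[OF X diagonal_coupling[OF \<mu>]]) (auto simp: m0)
    then show ?thesis by (simp add: algebra_simps)
  qed
  moreover have "0 < ?q * m + 1" using m0 by (simp add: add_nonneg_pos)
  ultimately show thesis by (rule that[rotated])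
qed

text \<open>Shows that a coupling exists at all. Its cost is bounded by the two first moments, which
  makes the infimum behind \<open>W1\<close> finite.\<close>

lemma product_coupling:
  assumes \<nu>: "\<nu> \<in> P1" and \<mu>: "\<mu> \<in> P1"
  shows "\<nu> \<Otimes>\<^sub>M \<mu> \<in> couplings \<nu> \<mu>"
proof -
  interpret N: prob_space \<nu> using P1_D(1)[OF \<nu>] .
  interpret M: prob_space \<mu> using P1_D(1)[OF \<mu>] .
  interpret P: pair_prob_space \<nu> \<mu> ..
  have sets: "sets (\<nu> \<Otimes>\<^sub>M \<mu>) = sets (PDborel \<Otimes>\<^sub>M PDborel)"
    by (intro sets_pair_measure_cong P1_D \<nu> \<mu>)
  have "distr (\<nu> \<Otimes>\<^sub>M \<mu>) PDborel fst = distr (\<nu> \<Otimes>\<^sub>M \<mu>) \<nu> fst"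
    "distr (\<nu> \<Otimes>\<^sub>M \<mu>) PDborel snd = distr (\<nu> \<Otimes>\<^sub>M \<mu>) \<mu> snd"
    using P1_D(2)[OF \<nu>] P1_D(2)[OF \<mu>] by (auto intro!: distr_cong)
  moreover have "distr (\<nu> \<Otimes>\<^sub>M \<mu>) \<nu> fst = \<nu>" by (rule M.distr_pair_fst)
  moreover have "distr (\<nu> \<Otimes>\<^sub>M \<mu>) \<mu> snd = \<mu>"
  proof (intro measure_eqI)
    fix A assume "A \<in> sets (distr (\<nu> \<Otimes>\<^sub>M \<mu>) \<mu> snd)"
    then have A: "A \<in> sets \<mu>" by simp
    then have "emeasure (distr (\<nu> \<Otimes>\<^sub>M \<mu>) \<mu> snd) A = emeasure (\<nu> \<Otimes>\<^sub>M \<mu>) (space \<nu> \<times> A)"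
      by (auto simp: emeasure_distr space_pair_measure dest: sets.sets_into_space intro!: arg_cong2[where f = emeasure])
    then show "emeasure (distr (\<nu> \<Otimes>\<^sub>M \<mu>) \<mu> snd) A = emeasure \<mu> A"
      using A by (simp add: M.emeasure_pair_measure_Times N.emeasure_space_1)
  qed simp
  ultimately show ?thesis
    using sets P.prob_space_axioms by (simp add: couplings_def)
qed

text \<open>Finiteness of the infimum matters: \<open>W1\<close> is an \<open>enn2real\<close>, which would be 0 at infinity.\<close>

lemma W1_less_coupling:
  assumes \<nu>: "\<nu> \<in> P1" and \<mu>: "\<mu> \<in> P1" and less: "W1 \<nu> \<mu> < \<delta>"
  obtains \<pi> where "\<pi> \<in> couplings \<nu> \<mu>" "(\<integral>\<^sup>+p. ennreal (thompson (fst p) (snd p)) \<partial>\<pi>) \<le> ennreal \<delta>"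
proof -
  let ?I = "INF \<pi>\<in>couplings \<nu> \<mu>. \<integral>\<^sup>+p. ennreal (rdist (fst p) (snd p)) \<partial>\<pi>"
  interpret N: prob_space \<nu> using P1_D(1)[OF \<nu>] .
  interpret M: prob_space \<mu> using P1_D(1)[OF \<mu>] .
  interpret P: pair_prob_space \<nu> \<mu> ..
  note [measurable_cong] = P1_D(2)[OF \<nu>] P1_D(2)[OF \<mu>]
  obtain X :: "'a cmat" where X: "X \<in> PD" using one_PD by blast
  then have [measurable]: "X \<in> space PDborel" by simp
  have "(\<integral>\<^sup>+p. ennreal (thompson (fst p) (snd p)) \<partial>(\<nu> \<Otimes>\<^sub>M \<mu>))
      \<le> (\<integral>\<^sup>+p. ennreal (thompson X (fst p)) + ennreal (thompson X (snd p)) \<partial>(\<nu> \<Otimes>\<^sub>M \<mu>))"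
  proof (rule nn_integral_mono)
    fix p assume "p \<in> space (\<nu> \<Otimes>\<^sub>M \<mu>)"
    then have "fst p \<in> PD" "snd p \<in> PD"
      using P1_D(3)[OF \<nu>] P1_D(3)[OF \<mu>] by (auto simp: space_pair_measure)
    then show "ennreal (thompson (fst p) (snd p)) \<le> ennreal (thompson X (fst p)) + ennreal (thompson X (snd p))"
      using thompson_triangle[of "fst p" X "snd p"] X
      by (simp add: thompson_nonneg thompson_commute[of _ X] ennreal_leI flip: ennreal_plus)
  qed
  also have "\<dots> = (\<integral>\<^sup>+p. ennreal (thompson X (fst p)) \<partial>(\<nu> \<Otimes>\<^sub>M \<mu>)) + (\<integral>\<^sup>+p. ennreal (thompson X (snd p)) \<partial>(\<nu> \<Otimes>\<^sub>M \<mu>))"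
    by (rule nn_integral_add) measurable
  also have "(\<integral>\<^sup>+p. ennreal (thompson X (fst p)) \<partial>(\<nu> \<Otimes>\<^sub>M \<mu>)) = (\<integral>\<^sup>+Z. ennreal (thompson X Z) \<partial>\<nu>)"
    by (subst couplings_D(4)[OF product_coupling[OF \<nu> \<mu>], symmetric], subst nn_integral_distr) auto
  also have "(\<integral>\<^sup>+p. ennreal (thompson X (snd p)) \<partial>(\<nu> \<Otimes>\<^sub>M \<mu>)) = (\<integral>\<^sup>+Z. ennreal (thompson X Z) \<partial>\<mu>)"
    by (subst (2) couplings_D(5)[OF product_coupling[OF \<nu> \<mu>], symmetric], subst nn_integral_distr) auto
  also have "(\<integral>\<^sup>+Z. ennreal (thompson X Z) \<partial>\<nu>) + (\<integral>\<^sup>+Z. ennreal (thompson X Z) \<partial>\<mu>) < \<infinity>"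
    using nn_integral_thompson_finite[OF \<nu> X] nn_integral_thompson_finite[OF \<mu> X] by simp
  finally have fin: "(\<integral>\<^sup>+p. ennreal (thompson (fst p) (snd p)) \<partial>(\<nu> \<Otimes>\<^sub>M \<mu>)) < \<infinity>" .
  have "?I \<le> (\<integral>\<^sup>+p. ennreal (rdist (fst p) (snd p)) \<partial>(\<nu> \<Otimes>\<^sub>M \<mu>))"
    by (rule INF_lower[OF product_coupling[OF \<nu> \<mu>]])
  also have "\<dots> \<le> ennreal (sqrt (real CARD('a))) * (\<integral>\<^sup>+p. ennreal (thompson (fst p) (snd p)) \<partial>(\<nu> \<Otimes>\<^sub>M \<mu>))"
    by (rule nn_integral_rdist_le) measurable
  also have "\<dots> < \<infinity>" using fin by (simp add: ennreal_mult_less_top)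
  finally have "?I = ennreal (W1 \<nu> \<mu>)" by (simp add: W1_def)
  also have "\<dots> < ennreal \<delta>" using less by (intro ennreal_lessI) (auto simp: W1_def intro: le_less_trans[OF enn2real_nonneg])
  finally have "?I < ennreal \<delta>" .
  then obtain \<pi> where \<pi>: "\<pi> \<in> couplings \<nu> \<mu>" and lt: "(\<integral>\<^sup>+p. ennreal (rdist (fst p) (snd p)) \<partial>\<pi>) < ennreal \<delta>"
    unfolding INF_less_iff by blast
  have "(\<integral>\<^sup>+p. ennreal (thompson (fst p) (snd p)) \<partial>\<pi>) \<le> (\<integral>\<^sup>+p. ennreal (rdist (fst p) (snd p)) \<partial>\<pi>)"
  proof (rule nn_integral_mono)
    fix p assume "p \<in> space \<pi>"
    then have "fst p \<in> PD" "snd p \<in> PD" by (simp_all add: couplings_D(3)[OF \<pi>] mem_Times_iff)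
    then show "ennreal (thompson (fst p) (snd p)) \<le> ennreal (rdist (fst p) (snd p))"
      by (intro ennreal_leI thompson_le_rdist)
  qed
  also note less_imp_le[OF lt]
  finally show thesis by (rule that[OF \<pi>])
qed

text \<open>Dominated convergence with the integrand itself as dominating function: at each point
  the indicator vanishes once the threshold exceeds the value of \<open>f\<close>.\<close>

lemma nn_integral_tail_small:
  assumes f [measurable]: "f \<in> borel_measurable M" and fin: "(\<integral>\<^sup>+x. ennreal (f x) \<partial>M) < \<infinity>" and "0 < (e::real)"
  obtains R where "0 \<le> R" "(\<integral>\<^sup>+x. ennreal (f x) * indicator {R<..} (f x) \<partial>M) \<le> ennreal e"
proof -
  have "(\<lambda>n. \<integral>\<^sup>+x. ennreal (f x) * indicator {real n<..} (f x) \<partial>M) \<longlonglongrightarrow> (\<integral>\<^sup>+x. 0 \<partial>M)"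
  proof (rule nn_integral_dominated_convergence[where w = "\<lambda>x. ennreal (f x)"])
    show "AE x in M. (\<lambda>n. ennreal (f x) * indicator {real n<..} (f x)) \<longlonglongrightarrow> 0"
    proof (rule AE_I2)
      fix x
      obtain N where "f x \<le> real N" using real_arch_simple by blast
      then have "eventually (\<lambda>n. ennreal (f x) * indicator {real n<..} (f x) = 0) sequentially"
        by (intro eventually_sequentiallyI[of N]) (auto simp: indicator_def)
      then show "(\<lambda>n. ennreal (f x) * indicator {real n<..} (f x)) \<longlonglongrightarrow> 0"
        by (rule tendsto_eventually)
    qed
  qed (use fin in \<open>auto simp: indicator_def\<close>)
  then have "eventually (\<lambda>n. (\<integral>\<^sup>+x. ennreal (f x) * indicator {real n<..} (f x) \<partial>M) < ennreal e) sequentially"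
    using \<open>0 < e\<close> by (intro order_tendstoD) auto
  then obtain n :: nat where "(\<integral>\<^sup>+x. ennreal (f x) * indicator {real n<..} (f x) \<partial>M) < ennreal e"
    by (auto simp: eventually_sequentially)
  then show thesis by (intro that[of "real n"]) auto
qed

text \<open>\<open>geo X t\<close> is not globally Lipschitz for \<open>\<bar>t\<bar> > 1\<close>. On balls around \<open>X\<close> it is uniformly
  continuous, and
  the part of a near-optimal coupling that is far from \<open>X\<close>, or that moves mass by more than \<open>\<eta>\<close>, is
  controlled by the tail of \<open>thompson X\<close> under \<open>\<mu>\<close> and by the transport cost divided by \<open>\<eta>\<close>.\<close>

lemma thompson_geo_split:
  assumes X: "X \<in> PD" and "0 < \<epsilon>" "0 \<le> R" "1 \<le> T"
  obtains \<eta> K where "0 < \<eta>" "0 < K"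
    "\<And>A B s t. A \<in> PD \<Longrightarrow> B \<in> PD \<Longrightarrow> \<bar>s\<bar> \<le> T \<Longrightarrow> \<bar>t\<bar> \<le> T \<Longrightarrow> \<bar>s - t\<bar> < \<eta> \<Longrightarrow>
      thompson (geo X s A) (geo X t B) \<le>
        \<epsilon> + K * thompson A B + 2 * T * (thompson X B * indicator {R<..} (thompson X B))"
proof -
  obtain \<eta>0 where "0 < \<eta>0"
    and \<eta>0: "\<And>A B s t. A \<in> PD \<Longrightarrow> B \<in> PD \<Longrightarrow> thompson X A \<le> R + 1 \<Longrightarrow> thompson X B \<le> R + 1 \<Longrightarrow>
      \<bar>s\<bar> \<le> T \<Longrightarrow> \<bar>t\<bar> \<le> T \<Longrightarrow> \<bar>s - t\<bar> < \<eta>0 \<Longrightarrow> thompson A B < \<eta>0 \<Longrightarrow>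
      thompson (geo X s A) (geo X t B) \<le> \<epsilon>"
    using thompson_geo_uniform[OF X \<open>0 < \<epsilon>\<close>, of "R + 1" T] assms by (auto; metis)
  \<comment> \<open>At most 1, so that \<open>b \<le> R\<close> and \<open>d < \<eta>\<close> place
    the other point within \<open>R + 1\<close>, the radius for which \<open>\<eta>0\<close> was
    obtained.\<close>
  define \<eta> where "\<eta> = min 1 \<eta>0"
  have "0 < \<eta>" "\<eta> \<le> 1" "\<eta> \<le> \<eta>0" using \<open>0 < \<eta>0\<close> by (auto simp: \<eta>_def)
  \<comment> \<open>The summand \<open>T\<close> absorbs the transport term of the growth bound
    \<open>far\<close>. The other one pays for a near point whose partner is at distance
    \<open>d \<ge> \<eta>\<close>: there \<open>R\<close> is at most
    \<open>R * d / \<eta>\<close>.\<close>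
  define K where "K = T + 2 * T * R / \<eta>"
  have "0 < K" using assms \<open>0 < \<eta>\<close> by (auto simp: K_def intro!: add_pos_nonneg)
  show thesis
  proof (rule that[OF \<open>0 < \<eta>\<close> \<open>0 < K\<close>])
    fix A B :: "'a cmat" and s t
    assume PD: "A \<in> PD" "B \<in> PD" and st: "\<bar>s\<bar> \<le> T" "\<bar>t\<bar> \<le> T" "\<bar>s - t\<bar> < \<eta>"
    define a b d where "a = thompson X A" and "b = thompson X B" and "d = thompson A B"
    have nn: "0 \<le> a" "0 \<le> b" "0 \<le> d" using X PD by (auto simp: a_def b_def d_def thompson_nonneg)
    \<comment> \<open>Trades the distance of the first point for that of the second plus the
      transport distance, so that the tail term contains only \<open>B\<close>.\<close>
    have ab: "a \<le> b + d"
      unfolding a_def b_def d_def using thompson_triangle[OF X PD(2,1)] by (simp add: thompson_commute)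
    have T: "0 \<le> T * R" "0 \<le> T" using assms by auto
    have "thompson (geo X s A) (geo X t B) \<le> \<bar>s\<bar> * a + \<bar>t\<bar> * b"
      unfolding a_def b_def by (rule thompson_geo_le[OF X PD])
    also have "\<dots> \<le> T * a + T * b" using st nn by (intro add_mono mult_right_mono) auto
    also have "\<dots> \<le> T * (b + d) + T * b" using ab T by (intro add_right_mono mult_left_mono)
    finally have far: "thompson (geo X s A) (geo X t B) \<le> T * d + 2 * T * b" by (simp add: algebra_simps)
    have K: "K * d = T * d + 2 * (T * R) * (d / \<eta>)" by (simp add: K_def algebra_simps)
    have Kd: "T * d \<le> K * d" using T nn \<open>0 < \<eta>\<close> by (simp add: K)
    consider "R < b" | "b \<le> R" "\<eta> \<le> d" | "b \<le> R" "d < \<eta>" by linarith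
    then have "thompson (geo X s A) (geo X t B) \<le> \<epsilon> + K * d + 2 * T * (b * indicator {R<..} b)"
    proof cases
      case 1
      then show ?thesis using far Kd \<open>0 < \<epsilon>\<close> by simp
    next
      case 2
      have "T * b \<le> T * R" using 2 T by (intro mult_left_mono)
      also have "\<dots> \<le> (T * R) * (d / \<eta>)" 
        using 2 T \<open>0 < \<eta>\<close> mult_left_mono[of 1 "d / \<eta>" "T * R"] by simp
      finally show ?thesis using far K 2 \<open>0 < \<epsilon>\<close> by simp
    next
      case 3
      then have "thompson (geo X s A) (geo X t B) \<le> \<epsilon>"
        using PD st ab \<open>\<eta> \<le> 1\<close> \<open>\<eta> \<le> \<eta>0\<close> by (intro \<eta>0) (auto simp: a_def b_def d_def)
      then show ?thesis using 3 nn \<open>0 < K\<close> by (simp add: add_increasing2)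
    qed
    then show "thompson (geo X s A) (geo X t B) \<le>
        \<epsilon> + K * thompson A B + 2 * T * (thompson X B * indicator {R<..} (thompson X B))"
      by (simp add: b_def d_def)
  qed
qed

text \<open>The pointwise split is integrated against a nearly optimal coupling and leaves three
  errors of size \<epsilon>. The tail term sees only the second marginal, the fixed
  \<open>\<mu>\<close>, so no uniform integrability of \<open>\<nu>\<close> has to be
  established.\<close>

lemma W1_geo_push_continuous:
  fixes X :: "'n::finite cmat"
  assumes X: "X \<in> PD" and \<mu>: "\<mu> \<in> P1" and "0 < e"
  obtains \<delta> where "0 < \<delta>"
    "\<And>s \<nu>. \<nu> \<in> P1 \<Longrightarrow> \<bar>s - t\<bar> + W1 \<nu> \<mu> < \<delta> \<Longrightarrow> W1 (geo_push X s \<nu>) (geo_push X t \<mu>) < e"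
proof -
  note [measurable_cong] = P1_D(2)[OF \<mu>]
  have [measurable]: "geo X r \<in> PDborel \<rightarrow>\<^sub>M PDborel" for r using X by measurable
  have [measurable]: "X \<in> space PDborel" using X by simp
  let ?q = "sqrt (real CARD('n))"
  have q: "0 < ?q" by simp
  \<comment> \<open>Three errors of size \<epsilon>, multiplied by \<open>?q\<close>, make three
    quarters of \<open>e\<close>, which leaves the inequality strict.\<close>
  define \<epsilon> where "\<epsilon> = e / (4 * ?q)"
  have \<epsilon>: "0 < \<epsilon>" using \<open>0 < e\<close> q by (simp add: \<epsilon>_def)
  \<comment> \<open>Since \<open>\<delta> \<le> 1\<close>, every admissible \<open>s\<close>
    satisfies \<open>\<bar>s\<bar> \<le> T\<close>.\<close>
  define T where "T = \<bar>t\<bar> + 1"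
  have T: "1 \<le> T" by (simp add: T_def)
  let ?tail = "\<lambda>R Z. ennreal (thompson X Z) * indicator {R<..} (thompson X Z)"
  \<comment> \<open>The factor \<open>2 * T\<close> is the weight of the tail term in the split, so
    that term contributes exactly \<epsilon>.\<close>
  obtain R where "0 \<le> R" and R: "(\<integral>\<^sup>+Z. ?tail R Z \<partial>\<mu>) \<le> ennreal (\<epsilon> / (2 * T))"
  proof (rule nn_integral_tail_small)
    show "(\<lambda>Z. thompson X Z) \<in> borel_measurable \<mu>" by measurable
    show "(\<integral>\<^sup>+Z. ennreal (thompson X Z) \<partial>\<mu>) < \<infinity>" by (rule nn_integral_thompson_finite[OF \<mu> X])
    show "0 < \<epsilon> / (2 * T)" using \<epsilon> T by simp
  qed
  obtain \<eta> K where "0 < \<eta>" "0 < K"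
    and split: "\<And>A B s t. A \<in> PD \<Longrightarrow> B \<in> PD \<Longrightarrow> \<bar>s\<bar> \<le> T \<Longrightarrow> \<bar>t\<bar> \<le> T \<Longrightarrow> \<bar>s - t\<bar> < \<eta> \<Longrightarrow>
      thompson (geo X s A) (geo X t B) \<le>
        \<epsilon> + K * thompson A B + 2 * T * (thompson X B * indicator {R<..} (thompson X B))"
    using thompson_geo_split[OF X \<epsilon> \<open>0 \<le> R\<close> T] by metis
  \<comment> \<open>The three bounds keep \<open>s\<close> within \<open>T\<close>, keep
    \<open>s\<close> within \<open>\<eta>\<close> of \<open>t\<close>, and hold \<open>K\<close>
    times the transport cost below \<epsilon>.\<close>
  define \<delta> where "\<delta> = min 1 (min \<eta> (\<epsilon> / K))"
  have \<delta>: "0 < \<delta>" "\<delta> \<le> 1" "\<delta> \<le> \<eta>" "K * \<delta> \<le> \<epsilon>"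
  proof -
    have "K * \<delta> \<le> K * (\<epsilon> / K)" using \<open>0 < K\<close> by (intro mult_left_mono) (auto simp: \<delta>_def)
    then show "K * \<delta> \<le> \<epsilon>" using \<open>0 < K\<close> by simp
  qed (use \<open>0 < \<eta>\<close> \<open>0 < K\<close> \<epsilon> in \<open>auto simp: \<delta>_def\<close>)
  show thesis
  proof (rule that[OF \<delta>(1)])
    fix s and \<nu> :: "'n cmat measure"
    assume \<nu>: "\<nu> \<in> P1" and less: "\<bar>s - t\<bar> + W1 \<nu> \<mu> < \<delta>"
    have "0 \<le> W1 \<nu> \<mu>" by (simp add: W1_def)
    then have st: "\<bar>s\<bar> \<le> T" "\<bar>t\<bar> \<le> T" "\<bar>s - t\<bar> < \<eta>" and W: "W1 \<nu> \<mu> < \<delta>"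
      using less \<delta> by (auto simp: T_def)
    obtain \<pi> where \<pi>: "\<pi> \<in> couplings \<nu> \<mu>"
      and cost: "(\<integral>\<^sup>+p. ennreal (thompson (fst p) (snd p)) \<partial>\<pi>) \<le> ennreal \<delta>"
      using W1_less_coupling[OF \<nu> \<mu> W] by blast
    interpret prob_space \<pi> using couplings_D(1)[OF \<pi>] .
    note [measurable_cong] = couplings_D(2)[OF \<pi>]
    have "(\<integral>\<^sup>+p. ennreal (thompson (geo X s (fst p)) (geo X t (snd p))) \<partial>\<pi>)
        \<le> (\<integral>\<^sup>+p. (ennreal \<epsilon> + ennreal K * ennreal (thompson (fst p) (snd p))) + ennreal (2 * T) * ?tail R (snd p) \<partial>\<pi>)"
    proof (rule nn_integral_mono)
      fix p assume "p \<in> space \<pi>"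
      then have p: "fst p \<in> PD" "snd p \<in> PD" by (simp_all add: couplings_D(3)[OF \<pi>] mem_Times_iff)
      have "ennreal (\<epsilon> + K * thompson (fst p) (snd p) + 2 * T * (thompson X (snd p) * indicator {R<..} (thompson X (snd p))))
        = (ennreal \<epsilon> + ennreal K * ennreal (thompson (fst p) (snd p))) + ennreal (2 * T) * ?tail R (snd p)"
        using X p \<epsilon> \<open>0 < K\<close> T
        by (cases "R < thompson X (snd p)") (simp_all add: thompson_nonneg ennreal_mult)
      with split[OF p st] show "ennreal (thompson (geo X s (fst p)) (geo X t (snd p)))
          \<le> (ennreal \<epsilon> + ennreal K * ennreal (thompson (fst p) (snd p))) + ennreal (2 * T) * ?tail R (snd p)"
        by (metis ennreal_leI)
    qed
    also have "\<dots> = ennreal \<epsilon> + ennreal K * (\<integral>\<^sup>+p. ennreal (thompson (fst p) (snd p)) \<partial>\<pi>)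
        + ennreal (2 * T) * (\<integral>\<^sup>+p. ?tail R (snd p) \<partial>\<pi>)"
      by (simp add: nn_integral_add nn_integral_cmult emeasure_space_1)
    also have "(\<integral>\<^sup>+p. ?tail R (snd p) \<partial>\<pi>) = (\<integral>\<^sup>+Z. ?tail R Z \<partial>\<mu>)"
      by (subst couplings_D(5)[OF \<pi>, symmetric], subst nn_integral_distr) auto
    also have "ennreal \<epsilon> + ennreal K * (\<integral>\<^sup>+p. ennreal (thompson (fst p) (snd p)) \<partial>\<pi>)
        + ennreal (2 * T) * (\<integral>\<^sup>+Z. ?tail R Z \<partial>\<mu>)
        \<le> ennreal \<epsilon> + ennreal K * ennreal \<delta> + ennreal (2 * T) * ennreal (\<epsilon> / (2 * T))"
      by (intro add_mono mult_left_mono cost R order_refl) auto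
    also have "\<dots> = ennreal (\<epsilon> + K * \<delta> + 2 * T * (\<epsilon> / (2 * T)))"
      using \<epsilon> \<delta> T \<open>0 < K\<close> by (simp flip: ennreal_mult ennreal_plus)
    also have "\<dots> \<le> ennreal (3 * \<epsilon>)"
      using \<delta> T by (intro ennreal_leI) (simp add: field_simps)
    finally have "W1 (geo_push X s \<nu>) (geo_push X t \<mu>) \<le> ?q * (3 * \<epsilon>)"
      using \<epsilon> by (intro W1_geo_push_le[OF X \<pi>]) auto
    also have "\<dots> < e" using q \<open>0 < e\<close> by (simp add: \<epsilon>_def field_simps)
    finally show "W1 (geo_push X s \<nu>) (geo_push X t \<mu>) < e" .
  qed
qed

lemma geo_push_geo_push:
  assumes X: "X \<in> PD" and \<mu>: "\<mu> \<in> P1"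
  shows "geo_push X s (geo_push X t \<mu>) = geo_push X (t * s) \<mu>"
proof -
  have "geo_push X s (geo_push X t \<mu>) = distr \<mu> PDborel (geo X s \<circ> geo X t)"
    unfolding geo_push_def using X P1_D(2)[OF \<mu>]
    by (intro distr_distr measurable_geo measurable_geo_P1) auto
  also have "\<dots> = geo_push X (t * s) \<mu>"
    unfolding geo_push_def using P1_D(3)[OF \<mu>] X by (intro distr_cong) (auto simp: geo_geo)
  finally show ?thesis .
qed

text \<open>\<open>P1\<close> is a plain set of measures, so joint continuity is expressed by
  epsilon and delta at each point, with \<open>\<bar>s - t\<bar> + W1 \<nu> \<mu>\<close> as the
  distance on the product.\<close>

theorem theorem2p4:
  fixes X :: "'n::finite cmat"
  assumes "X \<in> PD"
  shows "(\<forall>t. \<forall>\<mu>\<in>P1. geo_push X t \<mu> \<in> P1)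
    \<and> (\<forall>t. \<forall>\<mu>\<in>P1. \<forall>e>0. \<exists>\<delta>>0. \<forall>s. \<forall>\<nu>\<in>P1.
          \<bar>s - t\<bar> + W1 \<nu> \<mu> < \<delta> \<longrightarrow> W1 (geo_push X s \<nu>) (geo_push X t \<mu>) < e)
    \<and> (\<forall>t s. \<forall>\<mu>\<in>P1. geo_push X (t * s) \<mu> = geo_push X s (geo_push X t \<mu>))
    \<and> (\<forall>\<mu>\<in>P1. \<forall>T>0. \<exists>C>0. \<forall>t s. \<bar>t\<bar> \<le> T \<longrightarrow> \<bar>s\<bar> \<le> T \<longrightarrow>
          W1 (geo_push X t \<mu>) (geo_push X s \<mu>) \<le> C * \<bar>t - s\<bar>)"
proof (intro conjI allI ballI impI)
  fix t :: real and \<mu> :: "'n cmat measure"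
  assume \<mu>: "\<mu> \<in> P1"
  show "geo_push X t \<mu> \<in> P1" using assms \<mu> by (rule geo_push_P1)
  show "geo_push X (t * s) \<mu> = geo_push X s (geo_push X t \<mu>)" for s
    using geo_push_geo_push[OF assms \<mu>] by simp
  show "\<exists>\<delta>>0. \<forall>s. \<forall>\<nu>\<in>P1. \<bar>s - t\<bar> + W1 \<nu> \<mu> < \<delta> \<longrightarrow> W1 (geo_push X s \<nu>) (geo_push X t \<mu>) < e"
    if "0 < e" for e
    using W1_geo_push_continuous[OF assms \<mu> that, of t] by metis
  show "\<exists>C>0. \<forall>t s. \<bar>t\<bar> \<le> T \<longrightarrow> \<bar>s\<bar> \<le> T \<longrightarrow> W1 (geo_push X t \<mu>) (geo_push X s \<mu>) \<le> C * \<bar>t - s\<bar>" for T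
    using W1_geo_push_Lipschitz[OF assms \<mu>] by metis
qed

end
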